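(* Let $X=(X_t)_{t\ge 0}$ be a time-homogeneous continuous-time Markov chain with finite or countably infinite state space $\mathbb{X}\subset[0,\infty)$, and let $\delta$ be a discount function. Assume: (1) $\sup\mathbb{X}<\infty$ and $\sup_{x\in\mathbb{X}}\lambda_x<\infty$; (2) $X$ is irreducible, in the sense that for all $x,y\in\mathbb{X}$ the hitting time $\inf\{t\ge 0: X_t=y\}$ is finite almost surely when $X_0=x$; (3) $\delta(s)\delta(t)\le\delta(s+t)$ for all $s,t>0$; (4) $\delta$ is differentiable at $t=0$ with $\delta'(0)<0$. If $S\subset\mathbb{X}$ is an optimal mild equilibrium, then $S$ is a strong equilibrium.
   Context: For $x\in\mathbb{X}$, $\lambda_x$ is the total transition rate out of $x$ and $q_{xy}$ the transition rate from $x$ to $y\neq x$, so $\lambda_x=\sum_{y\ne x}q_{xy}$. $\mathbb{E}_x$ is expectation given $X_0=x$; the filtration is generated by $X$; paths are right-continuous with finitely many jumps on bounded time intervals. A discount function is a decreasing function $\delta:[0,\infty)\to[0,1]$ with $\delta(0)=1$ and $\lim_{t\to\infty}\delta(t)=0$; it is assumed to be non-exponential (not of the form $e^{-rt}$). For $S\subset\mathbb{X}$: $\tau_S:=\inf\{t\ge 0:X_t\in S\}$, $\tau_S^{\varepsilon}:=\inf\{t\ge\varepsilon:X_t\in S\}$ for $\varepsilon>0$, and $J(x,S):=\mathbb{E}_x[\delta(\tau_S)X_{\tau_S}]$, with $\delta(\tau)X_\tau:=0$ on $\{\tau=\infty\}$ (so $J(x,S)=x$ for $x\in S$ and $J(x,\emptyset)=0$).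 Mild equilibrium: $S\subset\mathbb{X}$ with $x\le J(x,S)$ for all $x\notin S$. Optimal mild equilibrium: a mild equilibrium $S^*$ such that $J(x,S^* )\ge J(x,S)$ for every mild equilibrium $S$ and every $x\in\mathbb{X}$. Strong equilibrium: $S\subset\mathbb{X}$ such that $x\le J(x,S)$ for all $x\notin S$, and for every $x\in S$ there is $\varepsilon=\varepsilon(x)>0$ such that $x\ge\mathbb{E}_x[\delta(\tau_S^{\varepsilon'})X_{\tau_S^{\varepsilon'}}]$ for all $\varepsilon'\in(0,\varepsilon)$. *)

theory Defs
  imports "HOL-Probability.Probability"
begin

definition natural_filtration ::
  "'w measure \<Rightarrow> real set \<Rightarrow> (real \<Rightarrow> 'w \<Rightarrow> real) \<Rightarrow> real \<Rightarrow> 'w measure" where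
  "natural_filtration N \<X> X s =
     sigma (space N) {X u -` A \<inter> space N | u A. 0 \<le> u \<and> u \<le> s \<and> A \<subseteq> \<X>}"

text \<open>
  \<open>P x\<close> is the law given \<open>X 0 = x\<close>, on the common measurable space \<open>N\<close>; only times \<open>t \<ge> 0\<close> matter.
  Continuity of the paths refers to the topology of the reals. Since the paths take countably many
  values, \<open>right_continuous\<close> and \<open>finitely_many_jumps\<close> make them step functions, so the discrete
  topology on the state space would give the same notion.
\<close>

locale ctmc =
  fixes \<X> :: "real set"
    and N :: "'w measure"
    and P :: "real \<Rightarrow> 'w measure"
    and X :: "real \<Rightarrow> 'w \<Rightarrow> real"
    and q :: "real \<Rightarrow> real \<Rightarrow> real"
    and rate_out :: "real \<Rightarrow> real"
  assumes countable_states: "countable \<X>"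
    and prob_space_P: "\<And>x. x \<in> \<X> \<Longrightarrow> prob_space (P x)"
    and sets_P: "\<And>x. x \<in> \<X> \<Longrightarrow> sets (P x) = sets N"
    and measurable_X: "\<And>t. 0 \<le> t \<Longrightarrow> X t \<in> measurable N (count_space \<X>)"
    and initial: "\<And>x. x \<in> \<X> \<Longrightarrow> AE \<omega> in P x. X 0 \<omega> = x"
    and right_continuous:
      "\<And>\<omega> t. \<omega> \<in> space N \<Longrightarrow> 0 \<le> t \<Longrightarrow> continuous (at_right t) (\<lambda>s. X s \<omega>)"
    and finitely_many_jumps:
      "\<And>\<omega> T. \<omega> \<in> space N \<Longrightarrow> finite {t \<in> {0<..T}. \<not> isCont (\<lambda>s. X s \<omega>) t}"
    and markov:
      "\<And>x y s t. x \<in> \<X> \<Longrightarrow> y \<in> \<X> \<Longrightarrow> 0 \<le> s \<Longrightarrow> 0 \<le> t \<Longrightarrow>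
         AE \<omega> in P x.
           real_cond_exp (P x) (natural_filtration N \<X> X s)
             (indicat_real {\<omega>' \<in> space N. X (s + t) \<omega>' = y}) \<omega>
           = measure (P (X s \<omega>)) {\<omega>' \<in> space N. X t \<omega>' = y}"
    and transition_rate:
      "\<And>x y. x \<in> \<X> \<Longrightarrow> y \<in> \<X> \<Longrightarrow> y \<noteq> x \<Longrightarrow>
         ((\<lambda>t. measure (P x) {\<omega> \<in> space N. X t \<omega> = y} / t) \<longlongrightarrow> q x y) (at_right 0)"
    and total_rate:
      "\<And>x. x \<in> \<X> \<Longrightarrow>
         ((\<lambda>t. measure (P x) {\<omega> \<in> space N. X t \<omega> \<noteq> x} / t) \<longlongrightarrow> rate_out x) (at_right 0)"
    and rate_out_sum: "\<And>x. x \<in> \<X> \<Longrightarrow> (q x has_sum rate_out x) (\<X> - {x})"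

text \<open>\<open>hitting_time X 0 S\<close> is \<open>\<tau>\<^sub>S\<close>, and \<open>hitting_time X \<epsilon> S\<close> is \<open>\<tau>\<^sub>S\<^sup>\<epsilon>\<close>; the value is \<open>\<infinity>\<close> if \<open>S\<close> is never hit.\<close>

definition hitting_time ::
  "(real \<Rightarrow> 'w \<Rightarrow> real) \<Rightarrow> real \<Rightarrow> real set \<Rightarrow> 'w \<Rightarrow> ereal" where
  "hitting_time X \<epsilon> S \<omega> = Inf (ereal ` {t. \<epsilon> \<le> t \<and> X t \<omega> \<in> S})"

definition irreducible_chain ::
  "real set \<Rightarrow> (real \<Rightarrow> 'w measure) \<Rightarrow> (real \<Rightarrow> 'w \<Rightarrow> real) \<Rightarrow> bool" where
  "irreducible_chain \<X> P X \<longleftrightarrow>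
     (\<forall>x\<in>\<X>. \<forall>y\<in>\<X>. AE \<omega> in P x. hitting_time X 0 {y} \<omega> < \<infinity>)"

text \<open>A function on \<open>[0,\<infinity>)\<close> is represented by a total function whose values at negative
  arguments are never used. Decreasing is meant in the weak sense.\<close>

definition discount_function :: "(real \<Rightarrow> real) \<Rightarrow> bool" where
  "discount_function \<delta> \<longleftrightarrow>
     antimono_on {0..} \<delta> \<and> \<delta> ` {0..} \<subseteq> {0..1} \<and> \<delta> 0 = 1 \<and> (\<delta> \<longlongrightarrow> 0) at_top \<and>
     \<not> (\<exists>r. \<forall>t\<ge>0. \<delta> t = exp (- r * t))"

definition discounted_state ::
  "(real \<Rightarrow> real) \<Rightarrow> (real \<Rightarrow> 'w \<Rightarrow> real) \<Rightarrow> ('w \<Rightarrow> ereal) \<Rightarrow> 'w \<Rightarrow> real" where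
  "discounted_state \<delta> X \<tau> \<omega> =
     (if \<tau> \<omega> = \<infinity> then 0 else \<delta> (real_of_ereal (\<tau> \<omega>)) * X (real_of_ereal (\<tau> \<omega>)) \<omega>)"

definition J ::
  "(real \<Rightarrow> 'w measure) \<Rightarrow> (real \<Rightarrow> 'w \<Rightarrow> real) \<Rightarrow> (real \<Rightarrow> real) \<Rightarrow> real \<Rightarrow> real set \<Rightarrow> real" where
  "J P X \<delta> x S = (\<integral>\<omega>. discounted_state \<delta> X (hitting_time X 0 S) \<omega> \<partial>P x)"

definition mild_equilibrium ::
  "real set \<Rightarrow> (real \<Rightarrow> 'w measure) \<Rightarrow> (real \<Rightarrow> 'w \<Rightarrow> real) \<Rightarrow> (real \<Rightarrow> real) \<Rightarrow> real set \<Rightarrow> bool" where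
  "mild_equilibrium \<X> P X \<delta> S \<longleftrightarrow> S \<subseteq> \<X> \<and> (\<forall>x\<in>\<X> - S. x \<le> J P X \<delta> x S)"

definition optimal_mild_equilibrium ::
  "real set \<Rightarrow> (real \<Rightarrow> 'w measure) \<Rightarrow> (real \<Rightarrow> 'w \<Rightarrow> real) \<Rightarrow> (real \<Rightarrow> real) \<Rightarrow> real set \<Rightarrow> bool" where
  "optimal_mild_equilibrium \<X> P X \<delta> S \<longleftrightarrow>
     mild_equilibrium \<X> P X \<delta> S \<and>
     (\<forall>S'. mild_equilibrium \<X> P X \<delta> S' \<longrightarrow> (\<forall>x\<in>\<X>. J P X \<delta> x S' \<le> J P X \<delta> x S))"

definition strong_equilibrium ::
  "real set \<Rightarrow> (real \<Rightarrow> 'w measure) \<Rightarrow> (real \<Rightarrow> 'w \<Rightarrow> real) \<Rightarrow> (real \<Rightarrow> real) \<Rightarrow> real set \<Rightarrow> bool" where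
  "strong_equilibrium \<X> P X \<delta> S \<longleftrightarrow>
     S \<subseteq> \<X> \<and>
     (\<forall>x\<in>\<X> - S. x \<le> J P X \<delta> x S) \<and>
     (\<forall>x\<in>S. \<exists>\<epsilon>>0. \<forall>\<epsilon>'\<in>{0<..<\<epsilon>}.
        (\<integral>\<omega>. discounted_state \<delta> X (hitting_time X \<epsilon>' S) \<omega> \<partial>P x) \<le> x)"

end

theory Submission
  imports Defs
begin

text \<open>
  Let \<open>r = - \<delta>'(0)\<close> and let \<open>\<lambda>\<close> be the exit rate of \<open>x \<in> S\<close>, \<open>x > 0\<close>. By the Markov property at a small
  time \<open>s\<close>, the value of restarting after \<open>s\<close> is at most \<open>x + s (L - (\<lambda> + r) x) + o(s)\<close>, where
  \<open>L = (\<Sum>y\<noteq>x. q x y * J(y, S))\<close>, so it suffices that \<open>L < (\<lambda> + r) x\<close>.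
  Suppose not, and put \<open>S' = S - {x}\<close> and \<open>v = J(x, S')\<close>. Since \<open>\<delta>\<close> is supermultiplicative, stopping at
  \<open>S\<close> and continuing from there to \<open>S'\<close> is worth at most \<open>J(y, S')\<close>. Hence \<open>v > x\<close> would make \<open>S'\<close> a mild
  equilibrium that beats \<open>S\<close> at \<open>x\<close>, so \<open>v \<le> x\<close> and \<open>J(y, S') \<ge> J(y, S) - (x - v)\<close>. On the other hand
  \<open>\<delta> t \<ge> exp (- r t)\<close>, with a fixed relative gain after some time because \<open>\<delta>\<close> is not exponential, so
  discounting over the holding time of \<open>x\<close> gives
  \<open>(\<lambda> + r) v \<ge> (1 + \<kappa>) (L - \<lambda> (x - v)) \<ge> (1 + \<kappa>) (r x + \<lambda> v)\<close> with \<open>\<kappa> > 0\<close>, contradicting \<open>v \<le> x\<close>.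
  If \<open>0 \<in> S\<close>, then \<open>J(0, S - {0}) = 0\<close>, and the chain started at \<open>0\<close> never reaches \<open>S - {0}\<close>.

  The strong Markov property and the law of the holding time are avoided by observing the chain at the
  times \<open>k e\<close>, where both only need the Markov property at deterministic times, and letting \<open>e\<close> tend to
  \<open>0\<close>: as the paths are step functions, the state at the first grid time in a set is eventually
  the state at the hitting time of that set.
\<close>

text \<open>Dominated convergence with bound \<open>norm (f \<omega>)\<close>. Two expectations can
  then be compared separately on each level set of \<open>\<kappa>\<close>, which later numbers
  either the current state or the first grid visit to a set.\<close>

lemma integral_partition_sums:
  fixes f :: "'a \<Rightarrow> real" and \<kappa> :: "'a \<Rightarrow> nat"
  assumes f: "integrable M f" and [measurable]: "\<kappa> \<in> measurable M (count_space UNIV)"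
  shows "(\<lambda>i. \<integral>\<omega>. indicator (\<kappa> -` {i}) \<omega> * f \<omega> \<partial>M) sums (\<integral>\<omega>. f \<omega> \<partial>M)"
proof -
  have [measurable]: "f \<in> borel_measurable M"
    using f by auto
  have int: "integrable M (\<lambda>\<omega>. indicator (\<kappa> -` {i}) \<omega> * f \<omega>)" for i
    using f by (rule Bochner_Integration.integrable_bound) (auto simp: indicator_def)
  have "(\<lambda>n. \<integral>\<omega>. (if \<kappa> \<omega> < n then f \<omega> else 0) \<partial>M) \<longlonglongrightarrow> (\<integral>\<omega>. f \<omega> \<partial>M)"
  proof (rule integral_dominated_convergence[where w = "\<lambda>\<omega>. norm (f \<omega>)"])
    show "AE \<omega> in M. (\<lambda>n. if \<kappa> \<omega> < n then f \<omega> else 0) \<longlonglongrightarrow> f \<omega>"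
    proof (rule AE_I2, rule tendsto_eventually)
      show "\<forall>\<^sub>F n in sequentially. (if \<kappa> \<omega> < n then f \<omega> else 0) = f \<omega>" for \<omega>
        using eventually_gt_at_top[of "\<kappa> \<omega>"] by eventually_elim simp
    qed
  qed (use f in auto)
  moreover have "(\<integral>\<omega>. (if \<kappa> \<omega> < n then f \<omega> else 0) \<partial>M) =
      (\<Sum>i<n. \<integral>\<omega>. indicator (\<kappa> -` {i}) \<omega> * f \<omega> \<partial>M)" for n
  proof -
    have "(\<integral>\<omega>. (if \<kappa> \<omega> < n then f \<omega> else 0) \<partial>M) =
        (\<integral>\<omega>. (\<Sum>i<n. indicator (\<kappa> -` {i}) \<omega> * f \<omega>) \<partial>M)"
      by (intro Bochner_Integration.integral_cong refl)
        (simp add: indicator_def of_bool_def if_distrib[where f = "\<lambda>c. c * _"] sum.delta cong: if_cong)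
    also have "\<dots> = (\<Sum>i<n. \<integral>\<omega>. indicator (\<kappa> -` {i}) \<omega> * f \<omega> \<partial>M)"
      by (intro Bochner_Integration.integral_sum int)
    finally show ?thesis .
  qed
  ultimately show ?thesis
    by (simp add: sums_def)
qed

text \<open>On this range \<open>(1 + 2 * y) * (1 - y)\<close> is at least \<open>1\<close>, and
  \<open>exp (2 * y)\<close> is at least \<open>1 + 2 * y\<close>. The bound later keeps a high
  power of a factor close to \<open>1\<close> away from \<open>0\<close>, uniformly in the mesh of
  the grid.\<close>

lemma exp_le_one_minus:
  fixes y :: real
  assumes "0 \<le> y" "y \<le> 1 / 2"
  shows "exp (- 2 * y) \<le> 1 - y"
proof -
  have "2 * (y * y) \<le> y"
    using mult_left_mono[OF assms(2,1)] by simp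
  then have "1 \<le> (1 + 2 * y) * (1 - y)"
    by (simp add: algebra_simps)
  also have "\<dots> \<le> exp (2 * y) * (1 - y)"
    using assms exp_ge_add_one_self[of "2 * y"] by (intro mult_right_mono) auto
  finally show ?thesis
    by (simp add: exp_minus field_simps)
qed

section \<open>Discount functions\<close>

text \<open>The derivative is one-sided because \<open>\<delta>\<close> has a meaning only at
  nonnegative times. Positivity of \<open>r\<close> is left to the individual lemmas that assume
  it.\<close>

locale discounting =
  fixes \<delta> :: "real \<Rightarrow> real" and r :: real
  assumes discount: "discount_function \<delta>"
    and log_superadditive: "\<And>s t. 0 < s \<Longrightarrow> 0 < t \<Longrightarrow> \<delta> s * \<delta> t \<le> \<delta> (s + t)"
    and derivative_0: "(\<delta> has_real_derivative - r) (at 0 within {0..})"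
begin

lemma delta_0 [simp]: "\<delta> 0 = 1"
  using discount by (simp add: discount_function_def)

lemma delta_nonneg: "0 \<le> t \<Longrightarrow> 0 \<le> \<delta> t"
  and delta_le_1: "0 \<le> t \<Longrightarrow> \<delta> t \<le> 1"
  using discount by (auto simp: discount_function_def image_subset_iff)

lemma delta_antimono: "0 \<le> s \<Longrightarrow> s \<le> t \<Longrightarrow> \<delta> t \<le> \<delta> s"
  using discount by (auto simp: discount_function_def monotone_on_def)

lemma delta_add: "0 \<le> s \<Longrightarrow> 0 \<le> t \<Longrightarrow> \<delta> s * \<delta> t \<le> \<delta> (s + t)"
  using log_superadditive[of s t] by (cases "s = 0"; cases "t = 0") auto

lemma delta_power: "0 \<le> t \<Longrightarrow> \<delta> t ^ n \<le> \<delta> (real n * t)"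
proof (induction n)
  case (Suc n)
  have "\<delta> t ^ Suc n \<le> \<delta> t * \<delta> (real n * t)"
    using Suc by (simp add: mult_left_mono delta_nonneg)
  also have "\<dots> \<le> \<delta> (real (Suc n) * t)"
    using delta_add[of t "real n * t"] Suc.prems by (simp add: algebra_simps)
  finally show ?case .
qed simp

lemma delta_quotient: "((\<lambda>t. (\<delta> t - 1) / t) \<longlongrightarrow> - r) (at_right 0)"
proof -
  have "((\<lambda>t. (\<delta> t - \<delta> 0) / (t - 0)) \<longlongrightarrow> - r) (at 0 within {0..})"
    using derivative_0 by (simp add: has_field_derivative_iff)
  from tendsto_within_subset[OF this, of "{0<..}"] show ?thesis
    by (simp add: subset_eq)
qed

lemma delta_tendsto_1: "(\<delta> \<longlongrightarrow> 1) (at_right 0)"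
proof -
  have "(\<delta> \<longlongrightarrow> \<delta> 0) (at 0 within {0..})"
    using derivative_0 by (metis DERIV_continuous continuous_within)
  from tendsto_within_subset[OF this, of "{0<..}"] show ?thesis
    by (simp add: subset_eq)
qed

text \<open>Supermultiplicativity bounds \<open>\<delta> t\<close> below by the \<open>n\<close>-th
  power of \<open>\<delta> (t / n)\<close>. For \<open>r' > r\<close> the derivative at
  \<open>0\<close> puts \<open>\<delta> (t / n)\<close> above \<open>exp (- r' * (t / n))\<close>
  once \<open>n\<close> is large; with \<open>r\<close> itself the difference quotient tends to
  \<open>0\<close> and decides nothing. Letting \<open>r'\<close> decrease to \<open>r\<close>
  removes the slack.\<close>

lemma delta_ge_exp:
  assumes "0 \<le> t"
  shows "exp (- r * t) \<le> \<delta> t"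
proof -
  have less: "exp (- r' * t) \<le> \<delta> t" if "r < r'" for r'
  proof (cases "t = 0")
    case False
    with assms have t: "0 < t" by simp
    have "((\<lambda>u. exp (- r' * u)) has_real_derivative - r') (at 0 within {0..})"
      by (auto intro!: derivative_eq_intros)
    from DERIV_diff[OF derivative_0 this]
    have "((\<lambda>u. (\<delta> u - exp (- r' * u)) / u) \<longlongrightarrow> r' - r) (at 0 within {0..})"
      by (simp add: has_field_derivative_iff)
    then have "((\<lambda>u. (\<delta> u - exp (- r' * u)) / u) \<longlongrightarrow> r' - r) (at_right 0)"
      by (rule tendsto_within_subset) auto
    then have "\<forall>\<^sub>F u in at_right 0. 0 < (\<delta> u - exp (- r' * u)) / u"
      using that by (intro order_tendstoD) auto
    moreover have "filterlim (\<lambda>n. t / real n) (at_right 0) sequentially"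
      using t by (intro filterlim_at_withinI tendsto_divide_0[OF tendsto_const]
          filterlim_at_top_imp_at_infinity filterlim_real_sequentially
          eventually_mono[OF eventually_gt_at_top[of 0]]) auto
    ultimately have "\<forall>\<^sub>F n in sequentially. 0 < (\<delta> (t / real n) - exp (- r' * (t / real n))) / (t / real n)"
      by (rule eventually_compose_filterlim)
    then have "\<forall>\<^sub>F n in sequentially. 0 < n \<and> 0 < (\<delta> (t / real n) - exp (- r' * (t / real n))) / (t / real n)"
      by (intro eventually_conj eventually_gt_at_top)
    then obtain n :: nat where n: "0 < n"
      and *: "0 < (\<delta> (t / real n) - exp (- r' * (t / real n))) / (t / real n)"
      by (auto dest: eventually_happens)
    moreover have "0 < t / real n"
      using n t by simp
    ultimately have "exp (- r' * (t / real n)) \<le> \<delta> (t / real n)"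
      by (simp only: pos_less_divide_eq)
    then have "exp (- r' * (t / real n)) ^ n \<le> \<delta> (t / real n) ^ n"
      by (intro power_mono) auto
    also have "\<dots> \<le> \<delta> (real n * (t / real n))"
      using t by (intro delta_power) auto
    finally show ?thesis
      using n by (simp flip: exp_of_nat_mult)
  qed simp
  have "((\<lambda>r'. exp (- r' * t)) \<longlongrightarrow> exp (- r * t)) (at_right r)"
    by (intro tendsto_intros)
  moreover have "\<forall>\<^sub>F r' in at_right r. exp (- r' * t) \<le> \<delta> t"
    using eventually_at_right_less[of r] by (rule eventually_mono) (rule less)
  ultimately show ?thesis
    by (rule tendsto_upperbound) (rule trivial_limit_at_right_real)
qed

lemma delta_pos: "0 \<le> t \<Longrightarrow> 0 < \<delta> t"
  using delta_ge_exp[of t] by (meson exp_gt_zero less_le_trans)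

text \<open>This is where non-exponentiality enters: \<open>\<delta>\<close> exceeds
  \<open>exp (- r * t)\<close> strictly at some \<open>t0\<close>, with relative gain
  \<open>c\<close>. Supermultiplicativity along \<open>t = t0 + (t - t0)\<close> passes the same
  gain on to every later time.\<close>

lemma delta_ge_exp_strict:
  obtains t0 c where "0 < t0" "0 < c" "\<And>t. t0 \<le> t \<Longrightarrow> (1 + c) * exp (- r * t) \<le> \<delta> t"
proof -
  obtain t0 where t0: "0 \<le> t0" "\<delta> t0 \<noteq> exp (- r * t0)"
    using discount by (auto simp: discount_function_def)
  then have "0 < t0" and gt: "exp (- r * t0) < \<delta> t0"
    using delta_ge_exp[of t0] by (auto simp: order_less_le)
  define c where "c = \<delta> t0 * exp (r * t0) - 1"
  have "exp (- r * t0) * exp (r * t0) < \<delta> t0 * exp (r * t0)"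
    using gt by (intro mult_strict_right_mono) auto
  then have "0 < c"
    by (simp add: c_def flip: exp_add)
  moreover have "(1 + c) * exp (- r * t) \<le> \<delta> t" if "t0 \<le> t" for t
  proof -
    have "(1 + c) * exp (- r * t) = \<delta> t0 * exp (- r * (t - t0))"
      by (simp add: c_def mult.assoc algebra_simps flip: exp_add)
    also have "\<dots> \<le> \<delta> t0 * \<delta> (t - t0)"
      using that t0 by (intro mult_left_mono delta_ge_exp delta_nonneg) auto
    also have "\<dots> \<le> \<delta> t"
      using delta_add[of t0 "t - t0"] that t0 by simp
    finally show ?thesis .
  qed
  ultimately show ?thesis
    using \<open>0 < t0\<close> that by blast
qed

end

section \<open>The Markov property along a time grid\<close>

context ctmc
begin

section \<open>Measurable events and the step structure of paths\<close>

lemma state_in: "\<omega> \<in> space N \<Longrightarrow> 0 \<le> t \<Longrightarrow> X t \<omega> \<in> \<X>"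
  using measurable_space[OF measurable_X] by simp

lemma space_P: "x \<in> \<X> \<Longrightarrow> space (P x) = space N"
  using sets_P by (rule sets_eq_imp_space_eq)

lemma measurable_P: "x \<in> \<X> \<Longrightarrow> measurable (P x) K = measurable N K"
  by (intro measurable_cong_sets sets_P refl)

lemma measurable_event [measurable]:
  assumes "0 \<le> t" shows "{\<omega> \<in> space N. X t \<omega> \<in> A} \<in> sets N"
proof -
  have "{\<omega> \<in> space N. X t \<omega> \<in> A} = X t -` (A \<inter> \<X>) \<inter> space N"
    using assms by (auto dest: state_in)
  also have "\<dots> \<in> sets N"
    using assms by (intro measurable_sets[OF measurable_X]) auto
  finally show ?thesis .
qed

text \<open>Only finitely many jumps lie nearby, so the path is continuous on some interval starting
  at \<open>t\<close>. Its image there is connected and countable, and a connected set of reals with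
  two points is uncountable.\<close>

lemma path_locally_constant:
  assumes "\<omega> \<in> space N" "0 \<le> t"
  obtains \<eta> where "0 < \<eta>" "\<And>s. t \<le> s \<Longrightarrow> s < t + \<eta> \<Longrightarrow> X s \<omega> = X t \<omega>"
proof -
  define D where "D = {u \<in> {0<..t + 1}. \<not> isCont (\<lambda>s. X s \<omega>) u}"
  have "finite D"
    using finitely_many_jumps[OF assms(1)] by (simp add: D_def)
  from finite_set_avoid[OF this, of t]
  obtain d where d: "0 < d" "\<And>u. u \<in> D \<Longrightarrow> u \<noteq> t \<Longrightarrow> d \<le> dist t u"
    by auto
  \<comment> \<open>The minimum with \<open>1\<close> keeps the interval inside the window on which
    \<open>D\<close> records the jumps.\<close>
  define \<eta> where "\<eta> = min d 1"
  have "0 < \<eta>"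
    using d by (simp add: \<eta>_def)
  have "continuous_on {t..<t + \<eta>} (\<lambda>s. X s \<omega>)"
    unfolding continuous_on_eq_continuous_within
  proof
    fix s assume s: "s \<in> {t..<t + \<eta>}"
    show "continuous (at s within {t..<t + \<eta>}) (\<lambda>s. X s \<omega>)"
    proof (cases "s = t")
      case True
      have "continuous (at t within {t..}) (\<lambda>s. X s \<omega>)"
        using right_continuous[OF assms]
        by (simp add: continuous_within at_within_Ici_at_right)
      then show ?thesis
        unfolding True by (rule continuous_within_subset) auto
    next
      case False
      then have "s \<notin> D"
        using d(2)[of s] s by (auto simp: \<eta>_def dist_real_def)
      then have "isCont (\<lambda>s. X s \<omega>) s"
        using s False assms by (auto simp: D_def \<eta>_def)
      then show ?thesis
        by (rule continuous_at_imp_continuous_at_within)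
    qed
  qed
  then have conn: "connected ((\<lambda>s. X s \<omega>) ` {t..<t + \<eta>})"
    by (rule connected_continuous_image) simp
  have "countable ((\<lambda>s. X s \<omega>) ` {t..<t + \<eta>})"
    using assms state_in by (intro countable_subset[OF _ countable_states]) auto
  then have "X s \<omega> = X t \<omega>" if "t \<le> s" "s < t + \<eta>" for s
    using connected_uncountable[OF conn, of "X s \<omega>" "X t \<omega>"] that \<open>0 < \<eta>\<close> by force
  with \<open>0 < \<eta>\<close> show ?thesis
    by (rule that)
qed

text \<open>Since the path is constant just after the infimum of the visiting times, that infimum is
  itself a visiting time. Hence a finite hitting time is a genuine first visit, for an arbitrary set
  \<open>A\<close>.\<close>

lemma hitting_time_cases:
  assumes "\<omega> \<in> space N" "0 \<le> s"
  obtains (never) "\<And>t. s \<le> t \<Longrightarrow> X t \<omega> \<notin> A" "hitting_time X s A \<omega> = \<infinity>"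
  | (hit) \<tau> where "s \<le> \<tau>" "hitting_time X s A \<omega> = ereal \<tau>" "X \<tau> \<omega> \<in> A"
      "\<And>t. s \<le> t \<Longrightarrow> t < \<tau> \<Longrightarrow> X t \<omega> \<notin> A"
proof (cases "{t. s \<le> t \<and> X t \<omega> \<in> A} = {}")
  case True
  then have "hitting_time X s A \<omega> = \<infinity>"
    unfolding hitting_time_def by (simp only: True) (simp add: top_ereal_def)
  then show ?thesis
    using True by (intro never) auto
next
  case False
  let ?T = "{t. s \<le> t \<and> X t \<omega> \<in> A}"
  define \<tau> where "\<tau> = Inf ?T"
  have bdd: "bdd_below ?T"
    by (auto intro: bdd_belowI)
  have "s \<le> \<tau>"
    unfolding \<tau>_def using False by (intro cInf_greatest) auto
  obtain \<eta> where \<eta>: "0 < \<eta>" "\<And>t. \<tau> \<le> t \<Longrightarrow> t < \<tau> + \<eta> \<Longrightarrow> X t \<omega> = X \<tau> \<omega>"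
    using path_locally_constant[OF assms(1), of \<tau>] assms(2) \<open>s \<le> \<tau>\<close> by auto
  obtain t where t: "t \<in> ?T" "t < \<tau> + \<eta>"
    using cInf_lessD[OF False, of "\<tau> + \<eta>"] \<eta>(1) by (auto simp: \<tau>_def)
  have lower: "\<tau> \<le> t" if "t \<in> ?T" for t
    unfolding \<tau>_def using that bdd by (rule cInf_lower)
  show ?thesis
  proof (rule hit[of \<tau>])
    show "hitting_time X s A \<omega> = ereal \<tau>"
      unfolding hitting_time_def \<tau>_def using ereal_Inf'[OF bdd False] by simp
    show "X \<tau> \<omega> \<in> A"
      using \<eta>(2)[OF lower[OF t(1)] t(2)] t(1) by simp
    show "X u \<omega> \<notin> A" if "s \<le> u" "u < \<tau>" for u
      using lower[of u] that by auto
  qed fact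
qed

section \<open>Sampling the chain at the times of a grid\<close>

abbreviation sequences :: "(nat \<Rightarrow> real) measure" where
  "sequences \<equiv> Pi\<^sub>M UNIV (\<lambda>_. count_space \<X>)"

definition grid_path :: "real \<Rightarrow> real \<Rightarrow> 'w \<Rightarrow> nat \<Rightarrow> real" where
  "grid_path s e \<omega> = (\<lambda>k. X (s + real k * e) \<omega>)"

lemma measurable_grid_path:
  assumes "0 \<le> s" "0 \<le> e"
  shows "grid_path s e \<in> measurable N sequences"
  unfolding grid_path_def
proof (rule measurable_PiM_single')
  show "(\<lambda>\<omega>. X (s + real k * e) \<omega>) \<in> measurable N (count_space \<X>)" for k
    using assms by (intro measurable_X) auto
  show "(\<lambda>\<omega> k. X (s + real k * e) \<omega>) \<in> space N \<rightarrow> (\<Pi>\<^sub>E k\<in>UNIV. space (count_space \<X>))"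
    using assms by (auto intro!: state_in)
qed

lemma measurable_sequence_event:
  "{w \<in> space sequences. w k \<in> A} \<in> sets sequences"
proof -
  have "{w \<in> space sequences. w k \<in> A} = (\<lambda>w. w k) -` (A \<inter> \<X>) \<inter> space sequences"
    by (auto simp: space_PiM)
  also have "\<dots> \<in> sets sequences"
    by (intro measurable_sets[OF measurable_component_singleton]) auto
  finally show ?thesis .
qed

lemma borel_measurable_state:
  assumes "0 \<le> t" shows "(\<lambda>\<omega>. g (X t \<omega>) :: real) \<in> borel_measurable N"
  by (rule measurable_compose[OF measurable_X[OF assms]]) simp

lemma integrable_P:
  assumes "x \<in> \<X>" "f \<in> borel_measurable N" "\<And>\<omega>. \<omega> \<in> space N \<Longrightarrow> \<bar>f \<omega>\<bar> \<le> C"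
  shows "integrable (P x) (f :: _ \<Rightarrow> real)"
proof -
  interpret prob_space "P x"
    using assms(1) by (rule prob_space_P)
  show ?thesis
    using assms by (intro integrable_const_bound[where B = C] AE_I2)
      (auto simp: space_P measurable_P)
qed

section \<open>The natural filtration and one Markov step\<close>

lemma space_filtration [simp]: "space (natural_filtration N \<X> X s) = space N"
  by (simp add: natural_filtration_def space_measure_of_conv)

lemma sets_filtration:
  "sets (natural_filtration N \<X> X s) =
     sigma_sets (space N) {X u -` A \<inter> space N | u A. 0 \<le> u \<and> u \<le> s \<and> A \<subseteq> \<X>}"
  unfolding natural_filtration_def by (intro sets_measure_of) auto

lemma filtration_event:
  assumes "0 \<le> u" "u \<le> s"
  shows "{\<omega> \<in> space N. X u \<omega> \<in> A} \<in> sets (natural_filtration N \<X> X s)"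
proof -
  have "{\<omega> \<in> space N. X u \<omega> \<in> A} = X u -` (A \<inter> \<X>) \<inter> space N"
    using assms by (auto dest: state_in)
  then show ?thesis
    unfolding sets_filtration using assms by (intro sigma_sets.Basic) blast
qed

lemma filtration_mono:
  assumes "s \<le> t"
  shows "sets (natural_filtration N \<X> X s) \<subseteq> sets (natural_filtration N \<X> X t)"
  unfolding sets_filtration using assms by (intro sigma_sets_mono') (blast intro: order_trans)

lemma filtration_subset: "sets (natural_filtration N \<X> X s) \<subseteq> sets N"
  unfolding sets_filtration
  by (intro sets.sigma_sets_subset) (auto intro!: measurable_sets[OF measurable_X])

text \<open>On \<open>B\<close> the state at time \<open>s\<close> is the fixed value
  \<open>z\<close>, so the conditional probability in the Markov property is constant there.
  Integrating it over \<open>B\<close> yields the product.\<close>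

lemma emeasure_markov_step:
  assumes x: "x \<in> \<X>" and z: "z \<in> \<X>" and y: "y \<in> \<X>" and s: "0 \<le> s" and t: "0 \<le> t"
    and B: "B \<in> sets (natural_filtration N \<X> X s)" "B \<subseteq> {\<omega>. X s \<omega> = z}"
  shows "emeasure (P x) (B \<inter> {\<omega> \<in> space N. X (s + t) \<omega> \<in> {y}}) =
    emeasure (P x) B * emeasure (P z) {\<omega> \<in> space N. X t \<omega> \<in> {y}}"
proof -
  let ?F = "natural_filtration N \<X> X s"
  let ?E = "{\<omega> \<in> space N. X (s + t) \<omega> = y}"
  interpret Px: prob_space "P x"
    using x by (rule prob_space_P)
  interpret Pz: prob_space "P z"
    using z by (rule prob_space_P)
  have "subalgebra (P x) ?F"
    using filtration_subset x by (simp add: subalgebra_def space_P sets_P)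
  then interpret finite_measure_subalgebra "P x" ?F
    by unfold_locales
  have BN: "B \<in> sets (P x)"
    using B(1) filtration_subset x sets_P by auto
  have EN: "?E \<in> sets (P x)"
    using measurable_event[of "s + t" "{y}"] s t x by (simp add: sets_P)
  have "Px.prob (B \<inter> ?E) = (\<integral>\<omega>\<in>B. indicat_real ?E \<omega> \<partial>P x)"
    using BN EN by (simp add: set_lebesgue_integral_def flip: indicator_inter_arith)
  also have "\<dots> = (\<integral>\<omega>\<in>B. real_cond_exp (P x) ?F (indicat_real ?E) \<omega> \<partial>P x)"
    using EN B(1) by (intro real_cond_exp_intA) (auto intro: Px.integrable_const_bound[where B = 1])
  also have "\<dots> = (\<integral>\<omega>\<in>B. Pz.prob {\<omega>' \<in> space N. X t \<omega>' = y} \<partial>P x)"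
    unfolding set_lebesgue_integral_def
  proof (rule integral_cong_AE)
    show "AE \<omega> in P x. indicat_real B \<omega> *\<^sub>R real_cond_exp (P x) ?F (indicat_real ?E) \<omega> =
      indicat_real B \<omega> *\<^sub>R Pz.prob {\<omega>' \<in> space N. X t \<omega>' = y}"
      using B(2) by (intro AE_mp[OF markov[OF x y s t] AE_I2]) (auto simp: indicator_def)
  qed (use BN in \<open>auto intro!: borel_measurable_scaleR\<close>)
  also have "\<dots> = Px.prob B * Pz.prob {\<omega>' \<in> space N. X t \<omega>' = y}"
    using BN by (simp add: set_lebesgue_integral_def)
  finally show ?thesis
    by (simp add: Px.emeasure_eq_measure Pz.emeasure_eq_measure ennreal_mult)
qed

lemma initial_event:
  assumes "x \<in> \<X>" shows "emeasure (P x) {\<omega> \<in> space N. X 0 \<omega> \<in> {x}} = 1"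
proof -
  interpret prob_space "P x"
    using assms by (rule prob_space_P)
  have "emeasure (P x) {\<omega> \<in> space (P x). X 0 \<omega> \<in> {x}} = 1"
    using initial[OF assms] measurable_event[of 0 "{x}"] assms
    by (intro emeasure_eq_1_AE) (auto simp: sets_P space_P)
  then show ?thesis
    using assms by (simp add: space_P)
qed

lemma emeasure_initial:
  assumes "x \<in> \<X>" "C \<in> sets N"
  shows "emeasure (P x) ({\<omega> \<in> space N. X 0 \<omega> \<in> {x}} \<inter> C) = emeasure (P x) C"
  using initial[OF assms(1)] assms measurable_event[of 0 "{x}"]
  by (intro emeasure_eq_AE) (auto simp: sets_P dest!: sets.sets_into_space)

section \<open>From one step to the law of the whole sampled future\<close>

definition cylinder :: "real \<Rightarrow> real \<Rightarrow> nat \<Rightarrow> (nat \<Rightarrow> real set) \<Rightarrow> 'w set" where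
  "cylinder s e k A = {\<omega> \<in> space N. \<forall>j\<le>k. X (s + real j * e) \<omega> \<in> A j}"

lemma sets_cylinder:
  assumes "0 \<le> s" "0 \<le> e" shows "cylinder s e k A \<in> sets N"
proof -
  have "cylinder s e k A = (\<Inter>j\<in>{..k}. {\<omega> \<in> space N. X (s + real j * e) \<omega> \<in> A j})"
    by (auto simp: cylinder_def)
  also have "\<dots> \<in> sets N"
    using assms by (intro sets.finite_INT) (auto intro!: measurable_event)
  finally show ?thesis .
qed

text \<open>Induction on \<open>k\<close>, splitting by the state at the next grid time. The factor
  is quantified before \<open>x\<close>, \<open>s\<close> and \<open>B\<close>, because the
  induction hypothesis is applied at the later time \<open>s + e\<close> and to a smaller event; its
  value is identified only afterwards.\<close>

lemma cylinder_factor: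
  assumes "0 \<le> e" "z \<in> \<X>"
  shows "\<exists>c. \<forall>x\<in>\<X>. \<forall>s\<ge>0. \<forall>B\<in>sets (natural_filtration N \<X> X s). B \<subseteq> {\<omega>. X s \<omega> = z} \<longrightarrow>
    emeasure (P x) (B \<inter> cylinder s e k A) = emeasure (P x) B * c"
  using assms(2)
proof (induction k arbitrary: z A)
  case 0
  have "B \<inter> cylinder s e 0 A = (if z \<in> A 0 then B else {})"
    if "B \<in> sets (natural_filtration N \<X> X s)" "B \<subseteq> {\<omega>. X s \<omega> = z}" for B s
    using that sets.sets_into_space[OF that(1)] by (auto simp: cylinder_def)
  then show ?case
    by (intro exI[of _ "if z \<in> A 0 then 1 else 0"]) simp
next
  case (Suc k)
  have "\<exists>c. \<forall>y\<in>\<X>. \<forall>x\<in>\<X>. \<forall>s\<ge>0. \<forall>B\<in>sets (natural_filtration N \<X> X s). B \<subseteq> {\<omega>. X s \<omega> = y} \<longrightarrow>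
    emeasure (P x) (B \<inter> cylinder s e k (\<lambda>j. A (Suc j))) = emeasure (P x) B * c y"
    using Suc.IH by (intro bchoice ballI)
  then obtain c where "\<forall>y\<in>\<X>. \<forall>x\<in>\<X>. \<forall>s\<ge>0. \<forall>B\<in>sets (natural_filtration N \<X> X s). B \<subseteq> {\<omega>. X s \<omega> = y} \<longrightarrow>
      emeasure (P x) (B \<inter> cylinder s e k (\<lambda>j. A (Suc j))) = emeasure (P x) B * c y" ..
  note c = this[rule_format]
  \<comment> \<open>The sum over the next state \<open>y\<close> of its transition probability times
    the factor for the rest of the path.\<close>
  let ?c = "\<integral>\<^sup>+y. emeasure (P z) {\<omega> \<in> space N. X e \<omega> \<in> {y}} * c y \<partial>count_space \<X>"
  have "emeasure (P x) (B \<inter> cylinder s e (Suc k) A) = emeasure (P x) B * (if z \<in> A 0 then ?c else 0)"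
    if x: "x \<in> \<X>" and s: "0 \<le> s"
      and B: "B \<in> sets (natural_filtration N \<X> X s)" "B \<subseteq> {\<omega>. X s \<omega> = z}" for x s B
  proof (cases "z \<in> A 0")
    case False
    then have "B \<inter> cylinder s e (Suc k) A = {}"
      using B(2) by (force simp: cylinder_def)
    with False show ?thesis by simp
  next
    case True
    define D where "D y = B \<inter> {\<omega> \<in> space N. X (s + e) \<omega> \<in> {y}}" for y
    have D: "D y \<in> sets (natural_filtration N \<X> X (s + e))" for y
      unfolding D_def using B(1) filtration_mono[of s "s + e"] s assms(1)
      by (intro sets.Int filtration_event) auto
    have D_sub: "D y \<subseteq> {\<omega>. X (s + e) \<omega> = y}" for y
      by (auto simp: D_def)
    have BN: "B \<subseteq> space N"
      using sets.sets_into_space[OF B(1)] by simp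
    have shift: "(\<forall>j\<le>Suc k. X (s + real j * e) \<omega> \<in> A j) \<longleftrightarrow>
        X s \<omega> \<in> A 0 \<and> (\<forall>j\<le>k. X (s + e + real j * e) \<omega> \<in> A (Suc j))" for \<omega>
    proof -
      have "X (s + e + real j * e) \<omega> = X (s + real (Suc j) * e) \<omega>" for j
        by (simp add: algebra_simps)
      then show ?thesis
        using All_less_Suc2[of "Suc k" "\<lambda>j. X (s + real j * e) \<omega> \<in> A j"]
        by (simp only: less_Suc_eq_le) simp
    qed
    have "B \<inter> cylinder s e (Suc k) A = (\<Union>y\<in>\<X>. D y \<inter> cylinder (s + e) e k (\<lambda>j. A (Suc j)))"
    proof (intro equalityI subsetI)
      fix \<omega> assume "\<omega> \<in> B \<inter> cylinder s e (Suc k) A"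
      then have "\<omega> \<in> B" "\<omega> \<in> space N" "\<forall>j\<le>k. X (s + e + real j * e) \<omega> \<in> A (Suc j)"
        using shift[of \<omega>] by (auto simp: cylinder_def)
      moreover have "X (s + e) \<omega> \<in> \<X>"
        using \<open>\<omega> \<in> space N\<close> s assms(1) by (intro state_in) auto
      ultimately show "\<omega> \<in> (\<Union>y\<in>\<X>. D y \<inter> cylinder (s + e) e k (\<lambda>j. A (Suc j)))"
        by (simp add: D_def cylinder_def)
    next
      fix \<omega> assume "\<omega> \<in> (\<Union>y\<in>\<X>. D y \<inter> cylinder (s + e) e k (\<lambda>j. A (Suc j)))"
      then have "\<omega> \<in> B" "\<omega> \<in> space N" "\<forall>j\<le>k. X (s + e + real j * e) \<omega> \<in> A (Suc j)"
        by (auto simp: D_def cylinder_def)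
      then show "\<omega> \<in> B \<inter> cylinder s e (Suc k) A"
        using shift[of \<omega>] B(2) True by (auto simp: cylinder_def)
    qed
    also have "emeasure (P x) \<dots> =
        (\<integral>\<^sup>+y. emeasure (P x) (D y \<inter> cylinder (s + e) e k (\<lambda>j. A (Suc j))) \<partial>count_space \<X>)"
    proof (rule emeasure_UN_countable)
      show "D y \<inter> cylinder (s + e) e k (\<lambda>j. A (Suc j)) \<in> sets (P x)" for y
        using D[of y] filtration_subset sets_cylinder[of "s + e" e] s assms(1) x
        by (auto simp: sets_P intro!: sets.Int)
      show "disjoint_family_on (\<lambda>y. D y \<inter> cylinder (s + e) e k (\<lambda>j. A (Suc j))) \<X>"
        by (auto simp: disjoint_family_on_def D_def)
    qed (rule countable_states)
    also have "\<dots> = (\<integral>\<^sup>+y. emeasure (P x) B *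
        (emeasure (P z) {\<omega> \<in> space N. X e \<omega> \<in> {y}} * c y) \<partial>count_space \<X>)"
    proof (rule nn_integral_cong)
      fix y assume "y \<in> space (count_space \<X>)"
      then have y: "y \<in> \<X>" by simp
      have "emeasure (P x) (D y \<inter> cylinder (s + e) e k (\<lambda>j. A (Suc j))) = emeasure (P x) (D y) * c y"
        using s assms(1) by (intro c y x D D_sub) auto
      also have "emeasure (P x) (D y) = emeasure (P x) B * emeasure (P z) {\<omega> \<in> space N. X e \<omega> \<in> {y}}"
        unfolding D_def by (rule emeasure_markov_step[OF x Suc.prems y s assms(1) B])
      finally show "emeasure (P x) (D y \<inter> cylinder (s + e) e k (\<lambda>j. A (Suc j))) =
          emeasure (P x) B * (emeasure (P z) {\<omega> \<in> space N. X e \<omega> \<in> {y}} * c y)"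
        by (simp add: mult.assoc)
    qed
    also have "\<dots> = emeasure (P x) B * ?c"
      by (rule nn_integral_cmult) simp
    finally show ?thesis
      using True by simp
  qed
  then show ?case
    by (intro exI[of _ "if z \<in> A 0 then ?c else 0"]) simp
qed

text \<open>The unknown factor of \<open>cylinder_factor\<close> is read off by starting in
  \<open>z\<close> at time \<open>0\<close> with \<open>B\<close> the event \<open>X 0 = z\<close>,
  which has probability \<open>1\<close>.\<close>

lemma emeasure_markov_cylinder:
  assumes "0 \<le> e" "x \<in> \<X>" "z \<in> \<X>" "0 \<le> s"
    and B: "B \<in> sets (natural_filtration N \<X> X s)" "B \<subseteq> {\<omega>. X s \<omega> = z}"
  shows "emeasure (P x) (B \<inter> cylinder s e k A) = emeasure (P x) B * emeasure (P z) (cylinder 0 e k A)"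
proof -
  obtain c where "\<forall>x\<in>\<X>. \<forall>s\<ge>0. \<forall>B\<in>sets (natural_filtration N \<X> X s). B \<subseteq> {\<omega>. X s \<omega> = z} \<longrightarrow>
      emeasure (P x) (B \<inter> cylinder s e k A) = emeasure (P x) B * c"
    using cylinder_factor[OF assms(1,3), of k A] ..
  note c = this[rule_format]
  have "emeasure (P z) (cylinder 0 e k A) =
      emeasure (P z) ({\<omega> \<in> space N. X 0 \<omega> \<in> {z}} \<inter> cylinder 0 e k A)"
    using assms by (intro emeasure_initial[symmetric] sets_cylinder) auto
  also have "\<dots> = emeasure (P z) {\<omega> \<in> space N. X 0 \<omega> \<in> {z}} * c"
    using assms filtration_event[of 0 0 "{z}"] by (intro c) auto
  also have "\<dots> = c"
    using assms by (simp only: initial_event mult_1)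
  finally show ?thesis
    using c[OF assms(2,4) B] by simp
qed

text \<open>Both sides are measures on the sequence space, finite on the left, and they agree on all
  sets that restrict finitely many coordinates. Such sets determine the measure.\<close>

lemma distr_markov:
  assumes e: "0 \<le> e" and x: "x \<in> \<X>" and z: "z \<in> \<X>" and s: "0 \<le> s"
    and B: "B \<in> sets (natural_filtration N \<X> X s)" "B \<subseteq> {\<omega>. X s \<omega> = z}"
  shows "distr (density (P x) (indicator B)) sequences (grid_path s e) =
    density (distr (P z) sequences (grid_path 0 e)) (\<lambda>_. emeasure (P x) B)"
proof (rule measure_eqI_PiM_infinite)
  interpret Px: prob_space "P x"
    using x by (rule prob_space_P)
  have BN: "B \<in> sets (P x)"
    using B(1) filtration_subset x sets_P by auto
  have mx: "grid_path s e \<in> measurable (density (P x) (indicator B)) sequences"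
    using measurable_grid_path[OF s e] x by (simp add: measurable_P)
  have mz: "grid_path 0 e \<in> measurable (P z) sequences"
    using measurable_grid_path[OF _ e, of 0] z by (simp add: measurable_P)
  show "finite_measure (distr (density (P x) (indicator B)) sequences (grid_path s e))"
    using BN mx
    by (intro finite_measure.finite_measure_distr finite_measureI) (simp_all add: emeasure_density nn_integral_indicator)
  fix A :: "nat \<Rightarrow> real set" and J :: "nat set"
  assume J: "finite J" "J \<subseteq> UNIV" and A: "\<And>j. j \<in> J \<Longrightarrow> A j \<in> sets (count_space \<X>)"
  let ?C = "prod_emb UNIV (\<lambda>_. count_space \<X>) J (Pi\<^sub>E J A)"
  \<comment> \<open>Unrestricted coordinates receive \<open>UNIV\<close>, so that a condition on an
    arbitrary finite set of indices becomes one on all indices up to \<open>k\<close>.\<close>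
  define A' where "A' j = (if j \<in> J then A j else UNIV)" for j
  obtain k where k: "j \<le> k" if "j \<in> J" for j
    using J(1) by (auto simp: finite_nat_set_iff_bounded_le)
  have C: "?C \<in> sets sequences"
    using J A by (intro sets_PiM_I) auto
  have pre: "grid_path u e -` ?C \<inter> space N = cylinder u e k A'" if "0 \<le> u" for u
    using k that e A
    by (auto simp: prod_emb_iff cylinder_def grid_path_def A'_def PiE_iff restrict_def extensional_def
        state_in split: if_splits)
  have "emeasure (distr (density (P x) (indicator B)) sequences (grid_path s e)) ?C =
      emeasure (P x) (B \<inter> cylinder s e k A')"
    using C mx BN x sets_cylinder[OF s e, of k A']
    by (simp add: emeasure_distr space_P pre s emeasure_restricted sets_P)
  also have "\<dots> = emeasure (P x) B * emeasure (P z) (cylinder 0 e k A')"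
    by (rule emeasure_markov_cylinder[OF e x z s B])
  also have "\<dots> = emeasure (density (distr (P z) sequences (grid_path 0 e)) (\<lambda>_. emeasure (P x) B)) ?C"
    using C mz z by (simp add: emeasure_density_const emeasure_distr space_P pre)
  finally show "emeasure (distr (density (P x) (indicator B)) sequences (grid_path s e)) ?C =
      emeasure (density (distr (P z) sequences (grid_path 0 e)) (\<lambda>_. emeasure (P x) B)) ?C" .
qed simp_all

lemma integral_markov_state:
  fixes f :: "(nat \<Rightarrow> real) \<Rightarrow> real"
  assumes e: "0 \<le> e" and x: "x \<in> \<X>" and z: "z \<in> \<X>" and s: "0 \<le> s"
    and B: "B \<in> sets (natural_filtration N \<X> X s)" "B \<subseteq> {\<omega>. X s \<omega> = z}"
    and f: "f \<in> borel_measurable sequences"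
  shows "(\<integral>\<omega>. indicator B \<omega> * f (grid_path s e \<omega>) \<partial>P x) =
    measure (P x) B * (\<integral>\<omega>. f (grid_path 0 e \<omega>) \<partial>P z)"
proof -
  interpret Px: prob_space "P x"
    using x by (rule prob_space_P)
  have BN: "B \<in> sets (P x)"
    using B(1) filtration_subset x sets_P by auto
  have mx: "grid_path s e \<in> measurable (P x) sequences"
    using measurable_grid_path[OF s e] x by (simp add: measurable_P)
  have mz: "grid_path 0 e \<in> measurable (P z) sequences"
    using measurable_grid_path[OF _ e, of 0] z by (simp add: measurable_P)
  have fx: "(\<lambda>\<omega>. f (grid_path s e \<omega>)) \<in> borel_measurable (P x)"
    using mx f by (rule measurable_compose)
  have "(\<integral>\<omega>. indicator B \<omega> * f (grid_path s e \<omega>) \<partial>P x) =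
      (\<integral>\<omega>. f (grid_path s e \<omega>) \<partial>density (P x) (\<lambda>\<omega>. ennreal (indicator B \<omega>)))"
    using BN fx by (subst integral_density) auto
  also have "\<dots> = (\<integral>w. f w \<partial>distr (density (P x) (indicator B)) sequences (grid_path s e))"
    using mx f by (subst integral_distr) (auto simp: ennreal_indicator)
  also have "\<dots> = (\<integral>w. f w \<partial>density (distr (P z) sequences (grid_path 0 e)) (\<lambda>_. ennreal (measure (P x) B)))"
    by (simp add: distr_markov[OF e x z s B] Px.emeasure_eq_measure)
  also have "\<dots> = measure (P x) B * (\<integral>\<omega>. f (grid_path 0 e \<omega>) \<partial>P z)"
    using mz f by (subst integral_density) (auto simp: integral_distr)
  finally show ?thesis .
qed

text \<open>There are only countably many states, so \<open>B\<close> can be cut according to the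
  state at time \<open>s\<close>, and \<open>integral_markov_state\<close> settles each piece.
  Boundedness of \<open>f\<close> makes both integrands integrable, so the pieces can be added
  up.\<close>

lemma integral_markov:
  fixes f :: "(nat \<Rightarrow> real) \<Rightarrow> real"
  assumes e: "0 \<le> e" and x: "x \<in> \<X>" and s: "0 \<le> s"
    and B: "B \<in> sets (natural_filtration N \<X> X s)"
    and f: "f \<in> borel_measurable sequences" "\<And>w. w \<in> space sequences \<Longrightarrow> \<bar>f w\<bar> \<le> C"
  shows "(\<integral>\<omega>. indicator B \<omega> * f (grid_path s e \<omega>) \<partial>P x) =
    (\<integral>\<omega>. indicator B \<omega> * (\<integral>\<omega>'. f (grid_path 0 e \<omega>') \<partial>P (X s \<omega>)) \<partial>P x)"
proof -
  interpret Px: prob_space "P x"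
    using x by (rule prob_space_P)
  define \<phi> where "\<phi> z = (\<integral>\<omega>'. f (grid_path 0 e \<omega>') \<partial>P z)" for z
  define \<kappa> where "\<kappa> \<omega> = to_nat_on \<X> (X s \<omega>)" for \<omega>
  have [measurable]: "\<kappa> \<in> measurable (P x) (count_space UNIV)"
    unfolding \<kappa>_def measurable_P[OF x] by (rule measurable_compose[OF measurable_X[OF s]]) simp
  have BN: "B \<in> sets N"
    using B filtration_subset by auto
  have C: "\<bar>f (grid_path u e \<omega>)\<bar> \<le> C" if "\<omega> \<in> space N" "0 \<le> u" for \<omega> u
    using measurable_space[OF measurable_grid_path[OF that(2) e] that(1)] by (rule f(2))
  have f': "(\<lambda>\<omega>. f (grid_path u e \<omega>)) \<in> borel_measurable N" if "0 \<le> u" for u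
    using measurable_grid_path[OF that e] f(1) by (rule measurable_compose)
  have \<phi>: "\<bar>\<phi> z\<bar> \<le> C" if "z \<in> \<X>" for z
  proof -
    interpret Pz: prob_space "P z"
      using that by (rule prob_space_P)
    have "\<bar>\<phi> z\<bar> \<le> (\<integral>\<omega>. \<bar>f (grid_path 0 e \<omega>)\<bar> \<partial>P z)"
      unfolding \<phi>_def by (rule integral_abs_bound)
    also have "\<dots> \<le> C"
      using that C f' by (intro Pz.integral_le_const integrable_P[where C = C] AE_I2) (auto simp: space_P)
    finally show ?thesis .
  qed
  have bound: "\<bar>indicator B \<omega> * a\<bar> \<le> C" if "\<bar>a\<bar> \<le> C" for a \<omega>
    using that by (auto simp: indicator_def)
  have int_f: "integrable (P x) (\<lambda>\<omega>. indicator B \<omega> * f (grid_path s e \<omega>))"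
    using x BN f' s C by (intro integrable_P[where C = C] bound) auto
  have int_\<phi>: "integrable (P x) (\<lambda>\<omega>. indicator B \<omega> * \<phi> (X s \<omega>))"
    using x BN s \<phi> by (intro integrable_P[where C = C] bound borel_measurable_times borel_measurable_state)
      (auto intro: state_in)
  have "(\<integral>\<omega>. indicator (\<kappa> -` {i}) \<omega> * (indicator B \<omega> * f (grid_path s e \<omega>)) \<partial>P x) =
      (\<integral>\<omega>. indicator (\<kappa> -` {i}) \<omega> * (indicator B \<omega> * \<phi> (X s \<omega>)) \<partial>P x)" for i
  proof (cases "i \<in> to_nat_on \<X> ` \<X>")
    case True
    then obtain z where z: "z \<in> \<X>" "i = to_nat_on \<X> z"
      by auto
    define B' where "B' = B \<inter> {\<omega> \<in> space N. X s \<omega> \<in> {z}}"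
    have B': "B' \<in> sets (natural_filtration N \<X> X s)" "B' \<subseteq> {\<omega>. X s \<omega> = z}"
      using B sets.Int[OF B filtration_event[of s s "{z}"]] s by (auto simp: B'_def)
    have \<kappa>_iff: "\<kappa> \<omega> = i \<longleftrightarrow> X s \<omega> = z" if "\<omega> \<in> space N" for \<omega>
      using inj_on_to_nat_on[OF countable_states] z state_in[OF that s]
      by (auto simp: \<kappa>_def inj_on_def)
    have "(\<integral>\<omega>. indicator (\<kappa> -` {i}) \<omega> * (indicator B \<omega> * f (grid_path s e \<omega>)) \<partial>P x) =
        (\<integral>\<omega>. indicator B' \<omega> * f (grid_path s e \<omega>) \<partial>P x)"
      using x by (intro Bochner_Integration.integral_cong refl)
        (auto simp: B'_def indicator_def \<kappa>_iff space_P)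
    also have "\<dots> = measure (P x) B' * \<phi> z"
      unfolding \<phi>_def by (rule integral_markov_state[OF e x z(1) s B' f(1)])
    also have "\<dots> = (\<integral>\<omega>. indicator B' \<omega> * \<phi> z \<partial>P x)"
      using B'(1) filtration_subset x by (simp add: sets_P subset_iff)
    also have "\<dots> = (\<integral>\<omega>. indicator (\<kappa> -` {i}) \<omega> * (indicator B \<omega> * \<phi> (X s \<omega>)) \<partial>P x)"
      using x by (intro Bochner_Integration.integral_cong refl)
        (auto simp: B'_def indicator_def \<kappa>_iff space_P)
    finally show ?thesis .
  next
    case False
    then have "\<kappa> \<omega> \<noteq> i" if "\<omega> \<in> space N" for \<omega>
      using state_in[OF that s] by (auto simp: \<kappa>_def)
    then show ?thesis
      using x by (intro Bochner_Integration.integral_cong refl) (auto simp: indicator_def space_P)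
  qed
  then show ?thesis
    using integral_partition_sums[OF int_f, of \<kappa>] integral_partition_sums[OF int_\<phi>, of \<kappa>]
    by (simp add: \<phi>_def[symmetric] sums_unique2)
qed

section \<open>Exit from a state\<close>

lemma rate_nonneg:
  assumes "x \<in> \<X>" "y \<in> \<X>" "y \<noteq> x" shows "0 \<le> q x y"
proof (rule tendsto_lowerbound[OF transition_rate[OF assms]])
  show "\<forall>\<^sub>F t in at_right 0. 0 \<le> measure (P x) {\<omega> \<in> space N. X t \<omega> = y} / t"
    using eventually_at_right_less[of 0] by (rule eventually_mono) simp
qed simp

lemma rate_out_nonneg:
  assumes "x \<in> \<X>" shows "0 \<le> rate_out x"
proof (rule tendsto_lowerbound[OF total_rate[OF assms]])
  show "\<forall>\<^sub>F t in at_right 0. 0 \<le> measure (P x) {\<omega> \<in> space N. X t \<omega> \<noteq> x} / t"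
    using eventually_at_right_less[of 0] by (rule eventually_mono) simp
qed simp

text \<open>The off-diagonal part of the transition semigroup applied to \<open>g\<close>. Divided
  by \<open>t\<close> it tends to the off-diagonal part of the generator, the sum of
  \<open>q x y * g y\<close> over \<open>y \<noteq> x\<close>.\<close>

definition exit_mean :: "(real \<Rightarrow> real) \<Rightarrow> real \<Rightarrow> real \<Rightarrow> real" where
  "exit_mean g x t = (\<integral>\<omega>. (if X t \<omega> = x then 0 else g (X t \<omega>)) \<partial>P x)"

lemma measurable_exit: "0 \<le> t \<Longrightarrow> (\<lambda>\<omega>. if X t \<omega> = x then 0 else g (X t \<omega>) :: real) \<in> borel_measurable N"
  by (rule borel_measurable_state[where g = "\<lambda>z. if z = x then 0 else g z"])

lemma integrable_exit:
  fixes g :: "real \<Rightarrow> real"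
  assumes "x \<in> \<X>" "0 \<le> t" "\<And>z. z \<in> \<X> \<Longrightarrow> \<bar>g z\<bar> \<le> C"
  shows "integrable (P x) (\<lambda>\<omega>. if X t \<omega> = x then 0 else g (X t \<omega>))"
proof (rule integrable_P[where C = C])
  show "\<bar>if X t \<omega> = x then 0 else g (X t \<omega>)\<bar> \<le> C" if "\<omega> \<in> space N" for \<omega>
    using assms(3)[OF assms(1)] assms(3)[OF state_in[OF that assms(2)]] by auto
qed (use assms in \<open>auto intro: measurable_exit\<close>)

text \<open>The two integrands agree while the chain is in \<open>F\<close> or in \<open>x\<close>.
  Elsewhere they differ by at most \<open>C\<close>, and the right-hand side is \<open>C\<close>
  times the probability of being elsewhere.\<close>

lemma exit_mean_approx:
  assumes x: "x \<in> \<X>" and t: "0 \<le> t" and F: "finite F" "F \<subseteq> \<X> - {x}"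
    and g: "\<And>z. z \<in> \<X> \<Longrightarrow> \<bar>g z\<bar> \<le> C"
  shows "\<bar>exit_mean g x t - (\<Sum>y\<in>F. measure (P x) {\<omega> \<in> space N. X t \<omega> = y} * g y)\<bar> \<le>
    C * (measure (P x) {\<omega> \<in> space N. X t \<omega> \<noteq> x} - (\<Sum>y\<in>F. measure (P x) {\<omega> \<in> space N. X t \<omega> = y}))"
proof -
  interpret prob_space "P x"
    using x by (rule prob_space_P)
  let ?E = "\<lambda>y. {\<omega> \<in> space N. X t \<omega> = y}" and ?D = "{\<omega> \<in> space N. X t \<omega> \<noteq> x}"
  have [simp]: "?E y \<in> sets (P x)" "?D \<in> sets (P x)" for y
    using measurable_event[OF t, of "{y}"] measurable_event[OF t, of "- {x}"] x by (simp_all add: sets_P)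
  have C: "0 \<le> C"
    using g[OF x] by simp
  let ?h = "\<lambda>\<omega>. (if X t \<omega> = x then 0 else g (X t \<omega>)) - (\<Sum>y\<in>F. indicator (?E y) \<omega> * g y)"
  let ?k = "\<lambda>\<omega>. C * (indicator ?D \<omega> - (\<Sum>y\<in>F. indicator (?E y) \<omega>))"
  have int_g: "integrable (P x) (\<lambda>\<omega>. if X t \<omega> = x then 0 else g (X t \<omega>))"
    using x t g by (rule integrable_exit)
  have ind: "integrable (P x) (indicat_real (?E y))" "integrable (P x) (indicat_real ?D)" for y
    by (auto intro!: integrable_real_indicator simp: less_top[symmetric])
  have le: "\<bar>?h \<omega>\<bar> \<le> ?k \<omega>" if "\<omega> \<in> space N" for \<omega>
  proof -
    have 1: "(\<Sum>y\<in>F. indicator (?E y) \<omega> * g y) = (if X t \<omega> \<in> F then g (X t \<omega>) else 0)"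
      using that F(1) by (simp add: indicator_def of_bool_def if_distrib[where f = "\<lambda>c. c * _"] sum.delta cong: if_cong)
    have 2: "(\<Sum>y\<in>F. indicat_real (?E y) \<omega>) = (if X t \<omega> \<in> F then 1 else 0)"
      using that F(1) by (simp add: indicator_def of_bool_def sum.delta)
    show ?thesis
      unfolding 1 2 using that F(2) g state_in[OF that t] C by (auto simp: indicator_def)
  qed
  have "exit_mean g x t - (\<Sum>y\<in>F. measure (P x) (?E y) * g y) = (\<integral>\<omega>. ?h \<omega> \<partial>P x)"
    unfolding exit_mean_def using int_g ind
    by (subst Bochner_Integration.integral_diff) auto
  then have "\<bar>exit_mean g x t - (\<Sum>y\<in>F. measure (P x) (?E y) * g y)\<bar> \<le> (\<integral>\<omega>. \<bar>?h \<omega>\<bar> \<partial>P x)"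
    by (simp only: integral_abs_bound)
  also have "\<dots> \<le> (\<integral>\<omega>. ?k \<omega> \<partial>P x)"
    using int_g ind le x
    by (intro integral_mono integrable_abs Bochner_Integration.integrable_diff integrable_mult_right
        Bochner_Integration.integrable_sum integrable_mult_left) (auto simp: space_P)
  also have "\<dots> = C * (measure (P x) ?D - (\<Sum>y\<in>F. measure (P x) (?E y)))"
    using ind by (simp add: Bochner_Integration.integral_diff)
  finally show ?thesis .
qed

text \<open>No mass escapes to infinity because the rates \<open>q x y\<close> add up to \<open>rate_out x\<close>.\<close>

lemma exit_mean_tendsto:
  assumes x: "x \<in> \<X>" and g: "\<And>z. z \<in> \<X> \<Longrightarrow> \<bar>g z\<bar> \<le> C"
  obtains L where "((\<lambda>t. exit_mean g x t / t) \<longlongrightarrow> L) (at_right 0)"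
proof -
  let ?D = "\<X> - {x}"
  have C: "0 \<le> C"
    using g[OF x] by simp
  have q: "(q x has_sum rate_out x) ?D"
    using x by (rule rate_out_sum)
  have "(\<lambda>y. C * q x y) summable_on ?D"
    using q by (intro summable_on_cmult_right) (auto simp: summable_on_def)
  then have "(\<lambda>y. norm (q x y * g y)) summable_on ?D"
  proof (rule Infinite_Sum.abs_summable_on_comparison_test')
    fix y assume y: "y \<in> ?D"
    then have "q x y * \<bar>g y\<bar> \<le> q x y * C"
      using x g by (intro mult_left_mono rate_nonneg) auto
    then show "norm (q x y * g y) \<le> C * q x y"
      using rate_nonneg[OF x, of y] y by (simp add: abs_mult mult.commute)
  qed
  then have "(\<lambda>y. q x y * g y) summable_on ?D"
    by (rule Infinite_Sum.abs_summable_summable)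
  then obtain L where L: "((\<lambda>y. q x y * g y) has_sum L) ?D"
    by (auto simp: summable_on_def)
  have "((\<lambda>t. exit_mean g x t / t) \<longlongrightarrow> L) (at_right 0)"
  proof (rule tendstoI)
    fix \<epsilon> :: real assume \<epsilon>: "0 < \<epsilon>"
    \<comment> \<open>Half of the tolerance is spent on the mass outside \<open>F\<close>, half on
      replacing \<open>L\<close> by a finite sum; \<open>C + 1\<close> avoids dividing by
      \<open>0\<close>.\<close>
    define \<epsilon>1 where "\<epsilon>1 = \<epsilon> / (2 * (C + 1))"
    have \<epsilon>1: "0 < \<epsilon>1" "C * \<epsilon>1 < \<epsilon> / 2"
      using \<epsilon> C by (auto simp: \<epsilon>1_def field_simps)
    have "\<forall>\<^sub>F F in finite_subsets_at_top ?D.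
        finite F \<and> F \<subseteq> ?D \<and> dist (sum (q x) F) (rate_out x) < \<epsilon>1 \<and> dist (\<Sum>y\<in>F. q x y * g y) L < \<epsilon> / 2"
      using tendstoD[OF q[unfolded has_sum_def] \<epsilon>1(1)] tendstoD[OF L[unfolded has_sum_def], of "\<epsilon> / 2"] \<epsilon>
      by (intro eventually_conj) (auto simp: eventually_finite_subsets_at_top_weakI)
    from eventually_happens'[OF finite_subsets_at_top_neq_bot this]
    obtain F where F: "finite F" "F \<subseteq> ?D" "dist (sum (q x) F) (rate_out x) < \<epsilon>1"
        "dist (\<Sum>y\<in>F. q x y * g y) L < \<epsilon> / 2"
      by blast
    let ?p = "\<lambda>y t. measure (P x) {\<omega> \<in> space N. X t \<omega> = y}"
    \<comment> \<open>The error at time \<open>t\<close>: first the mass that leaves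
      \<open>x\<close> without landing in \<open>F\<close>, then the finitely many transition
      quotients that have not yet converged.\<close>
    let ?R = "\<lambda>t. C * (measure (P x) {\<omega> \<in> space N. X t \<omega> \<noteq> x} / t - (\<Sum>y\<in>F. ?p y t / t)) +
      \<bar>(\<Sum>y\<in>F. ?p y t / t * g y) - (\<Sum>y\<in>F. q x y * g y)\<bar>"
    have R: "(?R \<longlongrightarrow> C * (rate_out x - (\<Sum>y\<in>F. q x y)) +
        \<bar>(\<Sum>y\<in>F. q x y * g y) - (\<Sum>y\<in>F. q x y * g y)\<bar>) (at_right 0)"
      using F(2) x by (intro tendsto_intros total_rate transition_rate) auto
    have "C * (rate_out x - (\<Sum>y\<in>F. q x y)) \<le> C * \<epsilon>1"
      using F(3) C by (intro mult_left_mono) (auto simp: dist_real_def)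
    then have "\<forall>\<^sub>F t in at_right 0. ?R t < \<epsilon> / 2"
      using \<epsilon>1(2) by (intro order_tendstoD(2)[OF R]) simp
    then show "\<forall>\<^sub>F t in at_right 0. dist (exit_mean g x t / t) L < \<epsilon>"
      using eventually_at_right_less[of 0]
    proof eventually_elim
      case (elim t)
      have "\<bar>exit_mean g x t / t - (\<Sum>y\<in>F. ?p y t / t * g y)\<bar> =
          \<bar>exit_mean g x t - (\<Sum>y\<in>F. ?p y t * g y)\<bar> / t"
        using elim by (simp flip: diff_divide_distrib sum_divide_distrib)
      also have "\<dots> \<le> C * (measure (P x) {\<omega> \<in> space N. X t \<omega> \<noteq> x} - (\<Sum>y\<in>F. ?p y t)) / t"
        using elim F x g by (intro divide_right_mono exit_mean_approx) auto
      also have "\<dots> = C * (measure (P x) {\<omega> \<in> space N. X t \<omega> \<noteq> x} / t - (\<Sum>y\<in>F. ?p y t / t))"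
        by (simp flip: diff_divide_distrib sum_divide_distrib)
      finally show ?case
        using F(4) elim unfolding dist_real_def by linarith
    qed
  qed
  then show ?thesis ..
qed

text \<open>Each further grid time spent in \<open>x\<close> costs one Markov factor. The resulting
  power is the grid counterpart of the exponential law of the holding time.\<close>

lemma stay_event:
  assumes x: "x \<in> \<X>" and e: "0 \<le> e"
  defines "S \<equiv> \<lambda>k. {\<omega> \<in> space N. \<forall>j\<le>k. X (real j * e) \<omega> = x}"
  shows "S k \<in> sets (natural_filtration N \<X> X (real k * e))"
    and "measure (P x) (S k) = measure (P x) {\<omega> \<in> space N. X e \<omega> = x} ^ k"
proof -
  interpret prob_space "P x"
    using x by (rule prob_space_P)
  have S: "S k \<in> sets (natural_filtration N \<X> X (real k * e))" for k
  proof -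
    have "S k = (\<Inter>j\<in>{..k}. {\<omega> \<in> space N. X (real j * e) \<omega> \<in> {x}})"
      by (auto simp: S_def)
    also have "\<dots> \<in> sets (natural_filtration N \<X> X (real k * e))"
      using e by (intro sets.finite_INT filtration_event) (auto intro: mult_right_mono)
    finally show ?thesis .
  qed
  show "S k \<in> sets (natural_filtration N \<X> X (real k * e))"
    by (rule S)
  show "measure (P x) (S k) = measure (P x) {\<omega> \<in> space N. X e \<omega> = x} ^ k"
  proof (induction k)
    case 0
    have "S 0 = {\<omega> \<in> space N. X 0 \<omega> \<in> {x}}"
      by (auto simp: S_def)
    then show ?case
      using initial_event[OF x] by (simp add: emeasure_eq_measure)
  next
    case (Suc k)
    have "S (Suc k) = S k \<inter> {\<omega> \<in> space N. X (real k * e + e) \<omega> \<in> {x}}"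
      by (auto simp: S_def le_Suc_eq algebra_simps)
    moreover have "emeasure (P x) (S k \<inter> {\<omega> \<in> space N. X (real k * e + e) \<omega> \<in> {x}}) =
        emeasure (P x) (S k) * emeasure (P x) {\<omega> \<in> space N. X e \<omega> \<in> {x}}"
      using e by (intro emeasure_markov_step x S) (auto simp: S_def)
    ultimately have "measure (P x) (S (Suc k)) = measure (P x) (S k) * measure (P x) {\<omega> \<in> space N. X e \<omega> = x}"
      by (simp add: emeasure_eq_measure flip: ennreal_mult)
    with Suc show ?case
      by simp
  qed
qed

end

section \<open>Discounted payoffs\<close>

locale stopping_problem = ctmc \<X> N P X q rate_out + discounting \<delta> r
  for \<X> :: "real set" and N :: "'w measure" and P :: "real \<Rightarrow> 'w measure"
    and X :: "real \<Rightarrow> 'w \<Rightarrow> real" and q :: "real \<Rightarrow> real \<Rightarrow> real"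
    and rate_out :: "real \<Rightarrow> real" and \<delta> :: "real \<Rightarrow> real" and r :: real +
  assumes states_nonneg: "\<X> \<subseteq> {0..}" and states_bounded: "bdd_above \<X>"
begin

text \<open>The reward \<open>g\<close> is kept general: the identity gives the payoff of the
  problem, while a value function as reward describes stopping at \<open>A\<close> and then
  continuing towards another set.\<close>

definition payoff :: "real \<Rightarrow> real set \<Rightarrow> (real \<Rightarrow> real) \<Rightarrow> 'w \<Rightarrow> real" where
  "payoff s A g \<omega> =
     (if hitting_time X s A \<omega> = \<infinity> then 0
      else \<delta> (real_of_ereal (hitting_time X s A \<omega>)) * g (X (real_of_ereal (hitting_time X s A \<omega>)) \<omega>))"

lemma payoff_id: "payoff s A (\<lambda>z. z) = discounted_state \<delta> X (hitting_time X s A)"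
  by (simp add: fun_eq_iff payoff_def discounted_state_def)

lemma J_eq_payoff: "J P X \<delta> x A = (\<integral>\<omega>. payoff 0 A (\<lambda>z. z) \<omega> \<partial>P x)"
  by (simp add: J_def payoff_id)

text \<open>Index \<open>k\<close> stands for the time \<open>s + k * e\<close>. The function lives
  on sequences, so that it can be inserted into \<open>integral_markov\<close>; the offset
  \<open>s\<close> enters only through the discount.\<close>

definition grid_payoff :: "real \<Rightarrow> real \<Rightarrow> real set \<Rightarrow> (real \<Rightarrow> real) \<Rightarrow> (nat \<Rightarrow> real) \<Rightarrow> real" where
  "grid_payoff s e A g w =
     (if \<exists>k. w k \<in> A
      then \<delta> (s + real (LEAST k. w k \<in> A) * e) * g (w (LEAST k. w k \<in> A)) else 0)"

lemma grid_payoff_never: "(\<And>k. w k \<notin> A) \<Longrightarrow> grid_payoff s e A g w = 0"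
  by (simp add: grid_payoff_def)

lemma grid_payoff_hit:
  assumes "w k \<in> A" "\<And>j. j < k \<Longrightarrow> w j \<notin> A"
  shows "grid_payoff s e A g w = \<delta> (s + real k * e) * g (w k)"
proof -
  have "(LEAST k. w k \<in> A) = k"
    using assms by (metis Least_equality linorder_not_le)
  then show ?thesis
    unfolding grid_payoff_def using assms(1) by metis
qed

lemma grid_payoff_cases:
  fixes w :: "nat \<Rightarrow> real"
  obtains (never) "\<And>k. w k \<notin> A" | (hit) k where "w k \<in> A" "\<And>j. j < k \<Longrightarrow> w j \<notin> A"
proof (cases "\<exists>k. w k \<in> A")
  case True
  show ?thesis
  proof (rule hit)
    show "w (LEAST k. w k \<in> A) \<in> A"
      using True by (rule LeastI_ex)
    show "w j \<notin> A" if "j < (LEAST k. w k \<in> A)" for j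
      using that by (rule not_less_Least)
  qed
qed (use never in auto)

lemma abs_delta_mult_le:
  assumes "0 \<le> t" "\<bar>a\<bar> \<le> C" shows "\<bar>\<delta> t * a\<bar> \<le> C"
proof -
  have "\<bar>\<delta> t * a\<bar> \<le> 1 * C"
    unfolding abs_mult using assms delta_nonneg[of t] delta_le_1[of t]
    by (intro mult_mono) auto
  then show ?thesis by simp
qed

lemma abs_grid_payoff_le:
  assumes "0 \<le> s" "0 \<le> e" "\<And>z. z \<in> \<X> \<Longrightarrow> \<bar>g z\<bar> \<le> C" "\<And>k. w k \<in> \<X>"
  shows "\<bar>grid_payoff s e A g w\<bar> \<le> C"
proof (cases w A rule: grid_payoff_cases)
  case never
  then show ?thesis
    using assms(3)[OF assms(4), of 0] by (simp add: grid_payoff_never)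
next
  case (hit k)
  then show ?thesis
    using assms by (simp add: grid_payoff_hit abs_delta_mult_le)
qed

lemma abs_payoff_le:
  assumes "0 \<le> s" "\<And>z. z \<in> \<X> \<Longrightarrow> \<bar>g z\<bar> \<le> C" "\<omega> \<in> space N"
  shows "\<bar>payoff s A g \<omega>\<bar> \<le> C"
  using assms(3,1)
proof (cases rule: hitting_time_cases[where A = A])
  case never
  have "0 \<le> C"
    using assms(2)[OF state_in[OF assms(3), of 0]] by simp
  with never show ?thesis
    by (simp add: payoff_def)
next
  case (hit \<tau>)
  then show ?thesis
    using assms by (simp add: payoff_def abs_delta_mult_le state_in)
qed

lemma measurable_grid_payoff: "grid_payoff s e A g \<in> borel_measurable sequences"
proof -
  have [measurable]: "Measurable.pred sequences (\<lambda>w. w k \<in> A)" for k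
    using measurable_sequence_event by (simp add: pred_def)
  have g: "(\<lambda>w. g (w k)) \<in> borel_measurable sequences" for k
    by (rule measurable_compose[OF measurable_component_singleton[of k]]) auto
  have "(\<lambda>w. (\<lambda>k w. \<delta> (s + real k * e) * g (w k)) (LEAST k. w k \<in> A) w) \<in> borel_measurable sequences"
    by (rule measurable_compose_countable) (use g in measurable)
  then show ?thesis
    unfolding grid_payoff_def[abs_def] by measurable
qed

lemma measurable_grid_payoff_path:
  "0 \<le> s \<Longrightarrow> 0 \<le> e \<Longrightarrow> (\<lambda>\<omega>. grid_payoff b e A g (grid_path s e \<omega>)) \<in> borel_measurable N"
  by (rule measurable_compose[OF measurable_grid_path measurable_grid_payoff])

lemma grid_path_in: "\<omega> \<in> space N \<Longrightarrow> 0 \<le> s \<Longrightarrow> 0 \<le> e \<Longrightarrow> grid_path s e \<omega> k \<in> \<X>"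
  by (simp add: grid_path_def state_in)

text \<open>The first grid time \<open>T n\<close> not before the hitting time \<open>\<tau>\<close>
  exceeds it by less than \<open>e n\<close>, so eventually the path still has the value
  \<open>X \<tau> \<omega>\<close> there, and earlier grid times miss \<open>A\<close>. The reward
  may vary with \<open>n\<close> because it will itself be a value computed on the grid.\<close>

lemma grid_payoff_tendsto:
  assumes \<omega>: "\<omega> \<in> space N" and s: "0 \<le> s" and e: "\<And>n. 0 < e n" "e \<longlonglongrightarrow> 0"
    and g: "\<And>z. z \<in> \<X> \<Longrightarrow> (\<lambda>n. g n z) \<longlonglongrightarrow> g' z"
  shows "(\<lambda>n. grid_payoff s (e n) A (g n) (grid_path s (e n) \<omega>)) \<longlonglongrightarrow> payoff s A g' \<omega>"
  using \<omega> s
proof (cases rule: hitting_time_cases[where A = A])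
  case never
  have "grid_payoff s (e n) A (g n) (grid_path s (e n) \<omega>) = 0" for n
    using never(1) e(1)[of n] by (intro grid_payoff_never) (simp add: grid_path_def)
  with never show ?thesis
    by (simp add: payoff_def)
next
  case (hit \<tau>)
  have "0 \<le> \<tau>"
    using hit s by simp
  obtain \<eta> where \<eta>: "0 < \<eta>" "\<And>t. \<tau> \<le> t \<Longrightarrow> t < \<tau> + \<eta> \<Longrightarrow> X t \<omega> = X \<tau> \<omega>"
    using path_locally_constant[OF \<omega> \<open>0 \<le> \<tau>\<close>] by blast
  define k where "k n = nat \<lceil>(\<tau> - s) / e n\<rceil>" for n
  define T where "T n = s + real (k n) * e n" for n
  have k: "(\<tau> - s) / e n \<le> real (k n)" "real (k n) < (\<tau> - s) / e n + 1" for n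
  proof -
    have "0 \<le> (\<tau> - s) / e n"
      using hit(1) e(1)[of n] by simp
    then have "real (k n) = of_int \<lceil>(\<tau> - s) / e n\<rceil>"
      unfolding k_def by (subst of_nat_nat) auto
    then show "(\<tau> - s) / e n \<le> real (k n)" "real (k n) < (\<tau> - s) / e n + 1"
      by linarith+
  qed
  have T: "\<tau> \<le> T n" "T n < \<tau> + e n" for n
    using k[of n] e(1)[of n] by (auto simp: T_def field_simps)
  have before: "X (s + real j * e n) \<omega> \<notin> A" if "j < k n" for j n
  proof (rule hit(4))
    have "real j + 1 \<le> real (k n)"
      using that by linarith
    then have "real j < (\<tau> - s) / e n"
      using k(2)[of n] by linarith
    then show "s + real j * e n < \<tau>"
      using e(1)[of n] by (simp add: field_simps)
  qed (use e(1)[of n] in simp)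
  have "\<forall>\<^sub>F n in sequentially. e n < \<eta>"
    using e(2) \<eta>(1) by (rule order_tendstoD)
  then have ev: "\<forall>\<^sub>F n in sequentially. \<delta> (T n) * g n (X \<tau> \<omega>) =
      grid_payoff s (e n) A (g n) (grid_path s (e n) \<omega>)"
  proof eventually_elim
    case (elim n)
    then have "X (T n) \<omega> = X \<tau> \<omega>"
      using T[of n] by (intro \<eta>(2)) auto
    then show ?case
      using hit(3) before[of _ n] grid_payoff_hit[of "grid_path s (e n) \<omega>" "k n" A s "e n" "g n"]
      by (simp add: grid_path_def T_def)
  qed
  \<comment> \<open>Supermultiplicativity carries right-continuity of \<open>\<delta>\<close> from
    time \<open>0\<close> to \<open>\<tau>\<close>; monotonicity supplies the upper bound.\<close>
  have "(\<lambda>n. \<delta> (T n)) \<longlonglongrightarrow> \<delta> \<tau>"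
  proof (rule tendsto_sandwich)
    have "filterlim e (at_right 0) sequentially"
      using e by (simp add: filterlim_at less_imp_neq[THEN not_sym])
    then have "(\<lambda>n. \<delta> \<tau> * \<delta> (e n)) \<longlonglongrightarrow> \<delta> \<tau> * 1"
      by (intro tendsto_intros filterlim_compose[OF delta_tendsto_1])
    then show "(\<lambda>n. \<delta> \<tau> * \<delta> (e n)) \<longlonglongrightarrow> \<delta> \<tau>"
      by simp
    have "\<delta> \<tau> * \<delta> (e n) \<le> \<delta> (T n)" for n
    proof -
      have "\<delta> \<tau> * \<delta> (e n) \<le> \<delta> (\<tau> + e n)"
        using \<open>0 \<le> \<tau>\<close> e(1)[of n] by (intro delta_add) auto
      also have "\<dots> \<le> \<delta> (T n)"
        using \<open>0 \<le> \<tau>\<close> T[of n] by (intro delta_antimono) auto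
      finally show ?thesis .
    qed
    then show "\<forall>\<^sub>F n in sequentially. \<delta> \<tau> * \<delta> (e n) \<le> \<delta> (T n)"
      by simp
    show "\<forall>\<^sub>F n in sequentially. \<delta> (T n) \<le> \<delta> \<tau>"
      using T(1) \<open>0 \<le> \<tau>\<close> by (simp add: delta_antimono)
  qed simp
  then have "(\<lambda>n. \<delta> (T n) * g n (X \<tau> \<omega>)) \<longlonglongrightarrow> \<delta> \<tau> * g' (X \<tau> \<omega>)"
    using g state_in[OF \<omega> \<open>0 \<le> \<tau>\<close>] by (intro tendsto_mult)
  from Lim_transform_eventually[OF this ev] show ?thesis
    using hit(2) by (simp add: payoff_def)
qed

text \<open>A pointwise limit of measurable grid payoffs; measurability of the hitting time is never
  addressed separately.\<close>

lemma measurable_payoff: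
  assumes "0 \<le> s" shows "payoff s A g \<in> borel_measurable N"
proof (rule borel_measurable_LIMSEQ_real)
  show "(\<lambda>n. grid_payoff s (1 / real (Suc n)) A g (grid_path s (1 / real (Suc n)) \<omega>)) \<longlonglongrightarrow> payoff s A g \<omega>"
    if "\<omega> \<in> space N" for \<omega>
    using that assms LIMSEQ_inverse_real_of_nat
    by (intro grid_payoff_tendsto[where g = "\<lambda>_. g"]) (auto simp: inverse_eq_divide)
  show "(\<lambda>\<omega>. grid_payoff s (1 / real (Suc n)) A g (grid_path s (1 / real (Suc n)) \<omega>)) \<in> borel_measurable N" for n
    using assms by (intro measurable_grid_payoff_path) auto
qed

lemma integrable_payoff:
  "x \<in> \<X> \<Longrightarrow> 0 \<le> s \<Longrightarrow> (\<And>z. z \<in> \<X> \<Longrightarrow> \<bar>g z\<bar> \<le> C) \<Longrightarrow> integrable (P x) (payoff s A g)"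
  by (rule integrable_P[where C = C]) (auto intro: measurable_payoff abs_payoff_le)

lemma integrable_grid_payoff:
  "x \<in> \<X> \<Longrightarrow> 0 \<le> b \<Longrightarrow> 0 \<le> s \<Longrightarrow> 0 \<le> e \<Longrightarrow> (\<And>z. z \<in> \<X> \<Longrightarrow> \<bar>g z\<bar> \<le> C) \<Longrightarrow>
    integrable (P x) (\<lambda>\<omega>. grid_payoff b e A g (grid_path s e \<omega>))"
  by (rule integrable_P[where C = C])
    (auto intro: measurable_grid_payoff_path abs_grid_payoff_le grid_path_in)

lemma integral_grid_payoff_tendsto:
  assumes x: "x \<in> \<X>" and s: "0 \<le> s" and e: "\<And>n. 0 < e n" "e \<longlonglongrightarrow> 0"
    and g: "\<And>z. z \<in> \<X> \<Longrightarrow> (\<lambda>n. g n z) \<longlonglongrightarrow> g' z" "\<And>n z. z \<in> \<X> \<Longrightarrow> \<bar>g n z\<bar> \<le> C"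
  shows "(\<lambda>n. \<integral>\<omega>. grid_payoff s (e n) A (g n) (grid_path s (e n) \<omega>) \<partial>P x)
           \<longlonglongrightarrow> (\<integral>\<omega>. payoff s A g' \<omega> \<partial>P x)"
proof (rule integral_dominated_convergence[where w = "\<lambda>_. C"])
  interpret prob_space "P x"
    using x by (rule prob_space_P)
  show "integrable (P x) (\<lambda>_. C)"
    by simp
  show "payoff s A g' \<in> borel_measurable (P x)"
    using x s by (simp add: measurable_P measurable_payoff)
  show "(\<lambda>\<omega>. grid_payoff s (e n) A (g n) (grid_path s (e n) \<omega>)) \<in> borel_measurable (P x)" for n
    using x s e(1)[of n] by (simp add: measurable_P measurable_grid_payoff_path)
  show "AE \<omega> in P x. (\<lambda>n. grid_payoff s (e n) A (g n) (grid_path s (e n) \<omega>)) \<longlonglongrightarrow> payoff s A g' \<omega>"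
    using x s e g(1) by (intro AE_I2 grid_payoff_tendsto) (auto simp: space_P)
  show "AE \<omega> in P x. norm (grid_payoff s (e n) A (g n) (grid_path s (e n) \<omega>)) \<le> C" for n
    using x s e(1)[of n] g(2) by (intro AE_I2) (auto simp: space_P intro!: abs_grid_payoff_le grid_path_in)
qed

section \<open>Values of stopping sets and their grid approximations\<close>

abbreviation stop_value :: "real \<Rightarrow> real set \<Rightarrow> real" where
  "stop_value \<equiv> J P X \<delta>"

definition grid_value :: "real \<Rightarrow> real set \<Rightarrow> real \<Rightarrow> real" where
  "grid_value e A y = (\<integral>\<omega>. grid_payoff 0 e A (\<lambda>z. z) (grid_path 0 e \<omega>) \<partial>P y)"

lemma state_nonneg: "z \<in> \<X> \<Longrightarrow> 0 \<le> z"
  using states_nonneg by auto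

lemma state_bound:
  obtains C where "\<And>z. z \<in> \<X> \<Longrightarrow> \<bar>z\<bar> \<le> C"
proof -
  obtain C where "\<And>z. z \<in> \<X> \<Longrightarrow> z \<le> C"
    using states_bounded by (auto simp: bdd_above_def)
  then show ?thesis
    using state_nonneg by (intro that[of C]) auto
qed

lemma abs_integral_le:
  assumes "x \<in> \<X>" "f \<in> borel_measurable N" "\<And>\<omega>. \<omega> \<in> space N \<Longrightarrow> \<bar>f \<omega> :: real\<bar> \<le> C"
  shows "\<bar>\<integral>\<omega>. f \<omega> \<partial>P x\<bar> \<le> C"
proof -
  interpret prob_space "P x"
    using assms(1) by (rule prob_space_P)
  have "\<bar>\<integral>\<omega>. f \<omega> \<partial>P x\<bar> \<le> (\<integral>\<omega>. \<bar>f \<omega>\<bar> \<partial>P x)"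
    by (rule integral_abs_bound)
  also have "\<dots> \<le> C"
    using assms by (intro integral_le_const integrable_P[where C = C] AE_I2) (auto simp: space_P)
  finally show ?thesis .
qed

lemma grid_value_bound:
  assumes "\<And>z. z \<in> \<X> \<Longrightarrow> \<bar>z\<bar> \<le> C" "0 \<le> e" "y \<in> \<X>"
  shows "\<bar>grid_value e A y\<bar> \<le> C"
  unfolding grid_value_def using assms
  by (intro abs_integral_le abs_grid_payoff_le measurable_grid_payoff_path grid_path_in) auto

lemma value_bound:
  assumes "\<And>z. z \<in> \<X> \<Longrightarrow> \<bar>z\<bar> \<le> C" "y \<in> \<X>"
  shows "\<bar>stop_value y A\<bar> \<le> C"
  unfolding J_eq_payoff using assms
  by (intro abs_integral_le abs_payoff_le measurable_payoff) auto

lemma payoff_mono: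
  assumes "0 \<le> s" "\<omega> \<in> space N" "\<And>z. z \<in> A \<Longrightarrow> z \<in> \<X> \<Longrightarrow> g z \<le> h z"
  shows "payoff s A g \<omega> \<le> payoff s A h \<omega>"
  using assms(2,1)
proof (cases rule: hitting_time_cases[where A = A])
  case (hit \<tau>)
  then show ?thesis
    using assms state_in[of \<omega> \<tau>] by (simp add: payoff_def mult_left_mono delta_nonneg)
qed (simp add: payoff_def)

lemma payoff_nonneg:
  assumes "0 \<le> s" "\<omega> \<in> space N" "\<And>z. z \<in> \<X> \<Longrightarrow> 0 \<le> g z"
  shows "0 \<le> payoff s A g \<omega>"
  using payoff_mono[OF assms(1,2), of A "\<lambda>_. 0" g] assms(3)
  by (simp add: payoff_def split: if_splits)

lemma value_nonneg: "y \<in> \<X> \<Longrightarrow> 0 \<le> stop_value y A"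
  unfolding J_eq_payoff
  by (intro integral_nonneg_AE AE_I2 payoff_nonneg) (auto simp: space_P state_nonneg)

lemma value_stop:
  assumes "x \<in> \<X>" "x \<in> A" shows "stop_value x A = x"
proof -
  interpret prob_space "P x"
    using assms(1) by (rule prob_space_P)
  have "payoff 0 A (\<lambda>z. z) \<omega> = x" if "\<omega> \<in> space N" "X 0 \<omega> = x" for \<omega>
    using that(1) order_refl
  proof (cases rule: hitting_time_cases[where A = A])
    case never
    then show ?thesis
      using never(1)[of 0] that assms by simp
  next
    case (hit \<tau>)
    then have "\<tau> = 0"
      using that assms by (metis order_refl le_less)
    then show ?thesis
      using hit that by (simp add: payoff_def)
  qed
  then have "AE \<omega> in P x. payoff 0 A (\<lambda>z. z) \<omega> = x"
    using assms by (intro AE_mp[OF initial[OF assms(1)] AE_I2]) (auto simp: space_P)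
  then have "stop_value x A = (\<integral>\<omega>. x \<partial>P x)"
    unfolding J_eq_payoff using assms measurable_payoff[of 0]
    by (intro integral_cong_AE) (auto simp: measurable_P)
  then show ?thesis
    by (simp add: prob_space)
qed

lemma grid_value_tendsto:
  assumes "y \<in> \<X>" "\<And>n. 0 < e n" "e \<longlonglongrightarrow> 0"
  shows "(\<lambda>n. grid_value (e n) A y) \<longlonglongrightarrow> stop_value y A"
proof -
  obtain C where "\<And>z. z \<in> \<X> \<Longrightarrow> \<bar>z\<bar> \<le> C"
    using state_bound by blast
  then show ?thesis
    unfolding grid_value_def J_eq_payoff using assms
    by (intro integral_grid_payoff_tendsto[where g = "\<lambda>_ z. z" and C = C]) auto
qed

text \<open>Before index \<open>k\<close> the sequence avoids \<open>A\<close>, hence also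
  \<open>A'\<close>, so restarting at \<open>k\<close> finds the same first visit to
  \<open>A'\<close>. The two payoffs differ only by discounting in two stages instead of one, which
  supermultiplicativity compares because the states are nonnegative.\<close>

lemma grid_payoff_restart:
  assumes A: "A' \<subseteq> A" and k: "\<And>j. j < k \<Longrightarrow> w j \<notin> A" and e: "0 \<le> e" and w: "\<And>j. 0 \<le> w j"
  shows "\<delta> (real k * e) * grid_payoff 0 e A' (\<lambda>z. z) (\<lambda>j. w (k + j)) \<le> grid_payoff 0 e A' (\<lambda>z. z) w"
proof (cases "\<lambda>j. w (k + j)" A' rule: grid_payoff_cases)
  case never
  have "w j \<notin> A'" for j
    using never[of "j - k"] k[of j] A by (cases "j < k") auto
  with never show ?thesis
    by (simp add: grid_payoff_never)
next
  case (hit m)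
  have "w j \<notin> A'" if "j < k + m" for j
    using hit(2)[of "j - k"] k[of j] A that by (cases "j < k") auto
  then have "grid_payoff 0 e A' (\<lambda>z. z) w = \<delta> (real k * e + real m * e) * w (k + m)"
    using hit(1) grid_payoff_hit[of w "k + m" A' 0 e "\<lambda>z. z"] by (simp add: distrib_right)
  moreover have "\<delta> (real k * e) * \<delta> (real m * e) * w (k + m) \<le> \<delta> (real k * e + real m * e) * w (k + m)"
    using e by (intro mult_right_mono w delta_add) auto
  ultimately show ?thesis
    using hit by (simp add: grid_payoff_hit mult.assoc)
qed

text \<open>The expectation is split by the index \<open>k\<close> of the first grid visit to
  \<open>A\<close>. On each piece the Markov property at the deterministic time \<open>k * e\<close>
  turns the continuation value into the payoff of the shifted path, and
  \<open>grid_payoff_restart\<close> compares pathwise.\<close>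

lemma grid_value_superharmonic:
  assumes A: "A' \<subseteq> A" and y: "y \<in> \<X>" and e: "0 \<le> e"
  shows "(\<integral>\<omega>. grid_payoff 0 e A (grid_value e A') (grid_path 0 e \<omega>) \<partial>P y) \<le> grid_value e A' y"
proof -
  obtain C where C: "\<And>z. z \<in> \<X> \<Longrightarrow> \<bar>z\<bar> \<le> C"
    using state_bound by blast
  define w where "w = grid_path 0 e"
  \<comment> \<open>The value \<open>0\<close> is reserved for paths that never visit
    \<open>A\<close> on the grid, hence the shift by one.\<close>
  define \<kappa> where "\<kappa> \<omega> = (if \<exists>k. w \<omega> k \<in> A then Suc (LEAST k. w \<omega> k \<in> A) else 0)" for \<omega>
  define V where "V \<omega> = grid_payoff 0 e A' (\<lambda>z. z) (w \<omega>)" for \<omega>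
  define U where "U \<omega> = grid_payoff 0 e A (grid_value e A') (w \<omega>)" for \<omega>
  have wX: "w \<omega> k = X (real k * e) \<omega>" for k \<omega>
    by (simp add: w_def grid_path_def)
  have [measurable]: "Measurable.pred (P y) (\<lambda>\<omega>. w \<omega> k \<in> A)" for k
    using measurable_event[of "real k * e" A] e y
    by (simp add: pred_def wX sets_P space_P)
  have \<kappa>: "\<kappa> \<in> measurable (P y) (count_space UNIV)"
    unfolding \<kappa>_def[abs_def] by measurable
  have V: "integrable (P y) V"
    unfolding V_def[abs_def] w_def using C y e by (intro integrable_grid_payoff[where C = C]) auto
  have U: "integrable (P y) U"
    unfolding U_def[abs_def] w_def using C y e
    by (intro integrable_grid_payoff[where C = C] grid_value_bound) auto
  have "(\<integral>\<omega>. indicator (\<kappa> -` {i}) \<omega> * U \<omega> \<partial>P y) \<le> (\<integral>\<omega>. indicator (\<kappa> -` {i}) \<omega> * V \<omega> \<partial>P y)" for i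
  proof (cases i)
    case 0
    have "indicator (\<kappa> -` {i}) \<omega> * U \<omega> = indicator (\<kappa> -` {i}) \<omega> * V \<omega>" for \<omega>
    proof (cases "\<kappa> \<omega> = 0")
      case True
      then have "w \<omega> k \<notin> A" for k
        by (auto simp: \<kappa>_def split: if_splits)
      then have "U \<omega> = 0" "V \<omega> = 0"
        unfolding U_def V_def using A by (auto intro!: grid_payoff_never)
      then show ?thesis by simp
    qed (simp add: 0)
    then show ?thesis by (simp only: order_refl)
  next
    case (Suc k)
    \<comment> \<open>\<open>B\<close> says that \<open>k\<close> is the first grid index in
      \<open>A\<close>. It is decided by time \<open>k * e\<close>, as
      \<open>integral_markov\<close> demands.\<close>
    define B where "B = {\<omega> \<in> space N. X (real k * e) \<omega> \<in> A} -
      (\<Union>j\<in>{..<k}. {\<omega> \<in> space N. X (real j * e) \<omega> \<in> A})"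
    have B_iff: "\<omega> \<in> B \<longleftrightarrow> w \<omega> k \<in> A \<and> (\<forall>j<k. w \<omega> j \<notin> A)" if "\<omega> \<in> space N" for \<omega>
      using that by (auto simp: B_def wX)
    have B: "B \<in> sets (natural_filtration N \<X> X (real k * e))"
      unfolding B_def using e
      by (intro sets.Diff sets.finite_UN filtration_event) (auto intro: mult_right_mono)
    have BN: "B \<in> sets N"
      using B filtration_subset by auto
    have \<kappa>_iff: "\<kappa> \<omega> = Suc k \<longleftrightarrow> \<omega> \<in> B" if "\<omega> \<in> space N" for \<omega>
    proof
      assume "\<kappa> \<omega> = Suc k"
      then have ex: "\<exists>k. w \<omega> k \<in> A" and k: "k = (LEAST k. w \<omega> k \<in> A)"
        by (auto simp: \<kappa>_def split: if_splits)
      have "w \<omega> k \<in> A"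
        unfolding k using ex by (rule LeastI_ex)
      moreover have "w \<omega> j \<notin> A" if "j < k" for j
        using that unfolding k by (rule not_less_Least)
      ultimately show "\<omega> \<in> B"
        using that by (simp add: B_iff)
    next
      assume "\<omega> \<in> B"
      then have k: "w \<omega> k \<in> A" "\<And>j. j < k \<Longrightarrow> w \<omega> j \<notin> A"
        using that by (auto simp: B_iff)
      then have "(LEAST k. w \<omega> k \<in> A) = k"
        by (metis Least_equality linorder_not_le)
      then show "\<kappa> \<omega> = Suc k"
        using k(1) by (auto simp: \<kappa>_def)
    qed
    have "(\<integral>\<omega>. indicator (\<kappa> -` {i}) \<omega> * U \<omega> \<partial>P y) =
        (\<integral>\<omega>. \<delta> (real k * e) * (indicator B \<omega> * grid_value e A' (X (real k * e) \<omega>)) \<partial>P y)"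
    proof (intro Bochner_Integration.integral_cong refl)
      fix \<omega> assume "\<omega> \<in> space (P y)"
      then have \<omega>: "\<omega> \<in> space N"
        using y by (simp add: space_P)
      show "indicator (\<kappa> -` {i}) \<omega> * U \<omega> =
          \<delta> (real k * e) * (indicator B \<omega> * grid_value e A' (X (real k * e) \<omega>))"
      proof (cases "\<omega> \<in> B")
        case True
        then have "U \<omega> = \<delta> (real k * e) * grid_value e A' (X (real k * e) \<omega>)"
          unfolding U_def using B_iff[OF \<omega>] by (subst grid_payoff_hit[of _ k]) (auto simp: wX)
        with True show ?thesis
          by (simp add: Suc \<kappa>_iff[OF \<omega>])
      qed (simp add: Suc \<kappa>_iff[OF \<omega>])
    qed
    also have "\<dots> = \<delta> (real k * e) * (\<integral>\<omega>. indicator B \<omega> * grid_value e A' (X (real k * e) \<omega>) \<partial>P y)"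
      by simp
    also have "(\<integral>\<omega>. indicator B \<omega> * grid_value e A' (X (real k * e) \<omega>) \<partial>P y) =
        (\<integral>\<omega>. indicator B \<omega> * grid_payoff 0 e A' (\<lambda>z. z) (grid_path (real k * e) e \<omega>) \<partial>P y)"
      unfolding grid_value_def using e
      by (intro integral_markov[where C = C, symmetric] e y B measurable_grid_payoff abs_grid_payoff_le C)
        (auto simp: space_PiM)
    also have "\<delta> (real k * e) * \<dots> =
        (\<integral>\<omega>. \<delta> (real k * e) * (indicator B \<omega> * grid_payoff 0 e A' (\<lambda>z. z) (grid_path (real k * e) e \<omega>)) \<partial>P y)"
      by simp
    also have "\<dots> \<le> (\<integral>\<omega>. indicator (\<kappa> -` {i}) \<omega> * V \<omega> \<partial>P y)"
    proof (rule integral_mono)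
      show "integrable (P y) (\<lambda>\<omega>. indicator (\<kappa> -` {i}) \<omega> * V \<omega>)"
        using V by (rule Bochner_Integration.integrable_bound)
          (use \<kappa> V in \<open>auto simp: indicator_def\<close>)
      show "integrable (P y) (\<lambda>\<omega>. \<delta> (real k * e) *
          (indicator B \<omega> * grid_payoff 0 e A' (\<lambda>z. z) (grid_path (real k * e) e \<omega>)))"
        using y e C BN
        by (intro integrable_mult_right integrable_P[where C = C] borel_measurable_times
            borel_measurable_indicator measurable_grid_payoff_path)
          (auto simp: indicator_def abs_grid_payoff_le grid_path_in intro: order_trans[OF abs_ge_zero])
      fix \<omega> assume "\<omega> \<in> space (P y)"
      then have \<omega>: "\<omega> \<in> space N"
        using y by (simp add: space_P)
      show "\<delta> (real k * e) * (indicator B \<omega> * grid_payoff 0 e A' (\<lambda>z. z) (grid_path (real k * e) e \<omega>)) \<le>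
          indicator (\<kappa> -` {i}) \<omega> * V \<omega>"
      proof (cases "\<omega> \<in> B")
        case True
        have "w \<omega> j \<notin> A" if "j < k" for j
          using True B_iff[OF \<omega>] that by blast
        moreover have "0 \<le> w \<omega> j" for j
          unfolding w_def using \<omega> e by (intro state_nonneg[OF grid_path_in]) auto
        ultimately have "\<delta> (real k * e) * grid_payoff 0 e A' (\<lambda>z. z) (\<lambda>j. w \<omega> (k + j)) \<le> V \<omega>"
          unfolding V_def using A e by (intro grid_payoff_restart[of A' A])
        moreover have "grid_path (real k * e) e \<omega> = (\<lambda>j. w \<omega> (k + j))"
          by (simp add: grid_path_def wX algebra_simps fun_eq_iff)
        ultimately have "\<delta> (real k * e) * grid_payoff 0 e A' (\<lambda>z. z) (grid_path (real k * e) e \<omega>) \<le> V \<omega>"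
          by simp
        with True show ?thesis
          by (simp add: Suc \<kappa>_iff[OF \<omega>])
      qed (simp add: Suc \<kappa>_iff[OF \<omega>])
    qed
    finally show ?thesis .
  qed
  from sums_le[OF this integral_partition_sums[OF U \<kappa>] integral_partition_sums[OF V \<kappa>]]
  show ?thesis
    by (simp add: U_def V_def w_def grid_value_def)
qed

text \<open>The limit of the grid inequality as the mesh tends to \<open>0\<close>; on the left the
  reward \<open>grid_value (e n) A'\<close> converges together with the stopping rule.\<close>

lemma value_superharmonic:
  assumes A: "A' \<subseteq> A" and y: "y \<in> \<X>"
  shows "(\<integral>\<omega>. payoff 0 A (\<lambda>z. stop_value z A') \<omega> \<partial>P y) \<le> stop_value y A'"
proof -
  obtain C where C: "\<And>z. z \<in> \<X> \<Longrightarrow> \<bar>z\<bar> \<le> C"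
    using state_bound by blast
  define e where "e n = inverse (real (Suc n))" for n
  have e: "\<And>n. 0 < e n" "e \<longlonglongrightarrow> 0"
    using LIMSEQ_inverse_real_of_nat by (auto simp: e_def[abs_def])
  have "(\<lambda>n. \<integral>\<omega>. grid_payoff 0 (e n) A (grid_value (e n) A') (grid_path 0 (e n) \<omega>) \<partial>P y)
      \<longlonglongrightarrow> (\<integral>\<omega>. payoff 0 A (\<lambda>z. stop_value z A') \<omega> \<partial>P y)"
    using e y C less_imp_le[OF e(1)]
    by (intro integral_grid_payoff_tendsto[where C = C] grid_value_tendsto grid_value_bound) auto
  moreover have "(\<lambda>n. grid_value (e n) A' y) \<longlonglongrightarrow> stop_value y A'"
    using y e by (rule grid_value_tendsto)
  ultimately show ?thesis
    using grid_value_superharmonic[OF A y less_imp_le[OF e(1)]] by (intro LIMSEQ_le) auto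
qed

text \<open>By the Markov property at time \<open>s\<close>; on the event that the chain has left \<open>x\<close> the elapsed
  time \<open>s\<close> is not discounted, which only enlarges the bound.\<close>

lemma delayed_payoff_le:
  assumes x: "x \<in> \<X>" "x \<in> A" and s: "0 \<le> s"
  shows "(\<integral>\<omega>. payoff s A (\<lambda>z. z) \<omega> \<partial>P x) \<le>
    (\<integral>\<omega>. (if X s \<omega> = x then \<delta> s * x else stop_value (X s \<omega>) A) \<partial>P x)"
proof -
  obtain C where C: "\<And>z. z \<in> \<X> \<Longrightarrow> \<bar>z\<bar> \<le> C"
    using state_bound by blast
  define e where "e n = inverse (real (Suc n))" for n
  have e: "\<And>n. 0 < e n" "e \<longlonglongrightarrow> 0"
    using LIMSEQ_inverse_real_of_nat by (auto simp: e_def[abs_def])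
  \<comment> \<open>Since \<open>x\<close> lies in \<open>A\<close>, a chain found in
    \<open>x\<close> at time \<open>s\<close> stops at once and collects
    \<open>\<delta> s * x\<close>.\<close>
  define b where "b n z = (if z = x then \<delta> s * x else grid_value (e n) A z)" for n z
  have b: "\<bar>b n z\<bar> \<le> C" if "z \<in> \<X>" for n z
    using that C x e(1)[of n] s by (auto simp: b_def intro!: abs_delta_mult_le grid_value_bound)
  have step: "(\<integral>\<omega>. grid_payoff s (e n) A (\<lambda>z. z) (grid_path s (e n) \<omega>) \<partial>P x) \<le>
      (\<integral>\<omega>. b n (X s \<omega>) \<partial>P x)" for n
  proof -
    have en: "0 \<le> e n"
      using e(1)[of n] by simp
    let ?\<phi> = "\<lambda>z. \<integral>\<omega>. grid_payoff s (e n) A (\<lambda>z. z) (grid_path 0 (e n) \<omega>) \<partial>P z"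
    have \<phi>_bound: "\<bar>?\<phi> z\<bar> \<le> C" if "z \<in> \<X>" for z
      using that C s en
      by (intro abs_integral_le abs_grid_payoff_le measurable_grid_payoff_path grid_path_in) auto
    have \<phi>: "?\<phi> z \<le> b n z" if z: "z \<in> \<X>" for z
    proof (cases "z = x")
      case True
      interpret prob_space "P x"
        using x(1) by (rule prob_space_P)
      have "AE \<omega> in P x. grid_payoff s (e n) A (\<lambda>z. z) (grid_path 0 (e n) \<omega>) = \<delta> s * x"
      proof (rule AE_mp[OF initial[OF x(1)] AE_I2], rule impI)
        fix \<omega> assume "X 0 \<omega> = x"
        then show "grid_payoff s (e n) A (\<lambda>z. z) (grid_path 0 (e n) \<omega>) = \<delta> s * x"
          using x(2) by (subst grid_payoff_hit[of _ 0]) (auto simp: grid_path_def)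
      qed
      then have "?\<phi> x = (\<integral>\<omega>. \<delta> s * x \<partial>P x)"
        using x en measurable_grid_payoff_path[of 0 "e n"]
        by (intro integral_cong_AE) (auto simp: measurable_P)
      then show ?thesis
        using True by (simp add: b_def prob_space)
    next
      case False
      have "?\<phi> z \<le> grid_value (e n) A z"
        unfolding grid_value_def
      proof (rule integral_mono)
        fix \<omega> assume "\<omega> \<in> space (P z)"
        then have \<omega>: "\<omega> \<in> space N"
          using z by (simp add: space_P)
        show "grid_payoff s (e n) A (\<lambda>z. z) (grid_path 0 (e n) \<omega>) \<le>
            grid_payoff 0 (e n) A (\<lambda>z. z) (grid_path 0 (e n) \<omega>)"
        proof (cases "grid_path 0 (e n) \<omega>" A rule: grid_payoff_cases)
          case (hit k)
          have "0 \<le> grid_path 0 (e n) \<omega> k"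
            using \<omega> en by (intro state_nonneg[OF grid_path_in]) auto
          moreover have "\<delta> (s + real k * e n) \<le> \<delta> (real k * e n)"
            using s en by (intro delta_antimono) auto
          ultimately show ?thesis
            using grid_payoff_hit[of "grid_path 0 (e n) \<omega>" k, OF hit]
            by (simp add: mult_right_mono)
        qed (simp add: grid_payoff_never)
      qed (use z en s C in \<open>auto intro!: integrable_grid_payoff[where C = C]\<close>)
      with False show ?thesis
        by (simp add: b_def)
    qed
    \<comment> \<open>The indicator of the whole space brings the integral into the form of
      \<open>integral_markov\<close>, with the trivial event as \<open>B\<close>.\<close>
    have "(\<integral>\<omega>. grid_payoff s (e n) A (\<lambda>z. z) (grid_path s (e n) \<omega>) \<partial>P x) =
        (\<integral>\<omega>. indicator (space N) \<omega> * grid_payoff s (e n) A (\<lambda>z. z) (grid_path s (e n) \<omega>) \<partial>P x)"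
      using x by (intro Bochner_Integration.integral_cong refl) (simp add: space_P)
    also have "\<dots> = (\<integral>\<omega>. indicator (space N) \<omega> * ?\<phi> (X s \<omega>) \<partial>P x)"
      using en s C x sets.top[of "natural_filtration N \<X> X s"]
      by (intro integral_markov[where C = C] measurable_grid_payoff abs_grid_payoff_le)
        (auto simp: space_PiM)
    also have "\<dots> = (\<integral>\<omega>. ?\<phi> (X s \<omega>) \<partial>P x)"
      using x by (intro Bochner_Integration.integral_cong refl) (simp add: space_P)
    also have "\<dots> \<le> (\<integral>\<omega>. b n (X s \<omega>) \<partial>P x)"
    proof (rule integral_mono)
      show "integrable (P x) (\<lambda>\<omega>. ?\<phi> (X s \<omega>))"
        using x s \<phi>_bound
        by (intro integrable_P[where C = C] borel_measurable_state[where g = ?\<phi>]) (auto intro: state_in)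
      show "integrable (P x) (\<lambda>\<omega>. b n (X s \<omega>))"
        using x s b
        by (intro integrable_P[where C = C] borel_measurable_state[where g = "b n"]) (auto intro: state_in)
    qed (use x s \<phi> in \<open>auto simp: space_P intro: state_in\<close>)
    finally show ?thesis .
  qed
  have "(\<lambda>n. \<integral>\<omega>. grid_payoff s (e n) A (\<lambda>z. z) (grid_path s (e n) \<omega>) \<partial>P x)
      \<longlonglongrightarrow> (\<integral>\<omega>. payoff s A (\<lambda>z. z) \<omega> \<partial>P x)"
    using e x s C by (intro integral_grid_payoff_tendsto[where g = "\<lambda>_ z. z" and C = C]) auto
  moreover have "(\<lambda>n. \<integral>\<omega>. b n (X s \<omega>) \<partial>P x) \<longlonglongrightarrow>
      (\<integral>\<omega>. (if X s \<omega> = x then \<delta> s * x else stop_value (X s \<omega>) A) \<partial>P x)"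
  proof (rule integral_dominated_convergence[where w = "\<lambda>_. C"])
    interpret prob_space "P x"
      using x(1) by (rule prob_space_P)
    show "integrable (P x) (\<lambda>_. C)"
      by simp
    show "(\<lambda>\<omega>. if X s \<omega> = x then \<delta> s * x else stop_value (X s \<omega>) A) \<in> borel_measurable (P x)"
      using borel_measurable_state[OF s, of "\<lambda>z. if z = x then \<delta> s * x else stop_value z A"] x
      by (simp add: measurable_P)
    show "(\<lambda>\<omega>. b n (X s \<omega>)) \<in> borel_measurable (P x)" for n
      using borel_measurable_state[OF s, of "b n"] x by (simp add: measurable_P)
    have "(\<lambda>n. b n (X s \<omega>)) \<longlonglongrightarrow> (if X s \<omega> = x then \<delta> s * x else stop_value (X s \<omega>) A)"
      if "\<omega> \<in> space N" for \<omega>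
      using that s e by (auto simp: b_def intro!: grid_value_tendsto state_in)
    then show "AE \<omega> in P x. (\<lambda>n. b n (X s \<omega>)) \<longlonglongrightarrow> (if X s \<omega> = x then \<delta> s * x else stop_value (X s \<omega>) A)"
      using x by (intro AE_I2) (simp only: space_P)
    show "AE \<omega> in P x. norm (b n (X s \<omega>)) \<le> C" for n
      using x s b by (auto simp: space_P state_in)
  qed
  ultimately show ?thesis
    using step by (intro LIMSEQ_le) auto
qed

section \<open>Optimal mild equilibria\<close>

text \<open>The payoff at the first grid exit is split by the exit index \<open>Suc k\<close>: the
  chain stays in \<open>x\<close> through index \<open>k\<close>, which has probability given by
  \<open>stay_event\<close>, and then leaves in one step. Cutting the sum at \<open>n\<close> only
  drops nonnegative terms.\<close>

lemma exit_grid_payoff_ge: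
  assumes x: "x \<in> \<X>" and e: "0 < e" and g: "\<And>z. z \<in> \<X> \<Longrightarrow> 0 \<le> g z" "\<And>z. z \<in> \<X> \<Longrightarrow> \<bar>g z\<bar> \<le> C"
  shows "(\<Sum>k<n. \<delta> (real (Suc k) * e) * measure (P x) {\<omega> \<in> space N. X e \<omega> = x} ^ k) * exit_mean g x e \<le>
    (\<integral>\<omega>. grid_payoff 0 e (- {x}) g (grid_path 0 e \<omega>) \<partial>P x)"
proof -
  interpret prob_space "P x"
    using x by (rule prob_space_P)
  have C: "0 \<le> C"
    using g(2)[OF x] by simp
  define S where "S k = {\<omega> \<in> space N. \<forall>j\<le>k. X (real j * e) \<omega> = x}" for k :: nat
  note S = stay_event[OF x less_imp_le[OF e], folded S_def]
  have SN: "S k \<in> sets (P x)" for k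
    using S(1)[of k] filtration_subset x by (auto simp: sets_P)
  \<comment> \<open>\<open>f\<close> looks only one grid step ahead, so its expectation from
    \<open>x\<close> is \<open>exit_mean g x e\<close>.\<close>
  define f where "f w = (if w 1 = x then 0 else g (w 1))" for w :: "nat \<Rightarrow> real"
  have f: "f \<in> borel_measurable sequences"
    unfolding f_def[abs_def]
    by (rule measurable_compose[OF measurable_component_singleton[of 1], where g = "\<lambda>z. if z = x then 0 else g z"]) auto
  have f_path: "f (grid_path u e \<omega>) = (if X (u + e) \<omega> = x then 0 else g (X (u + e) \<omega>))" for u \<omega>
    by (simp add: f_def grid_path_def)
  let ?Z = "\<lambda>k \<omega>. \<delta> (real (Suc k) * e) * (indicator (S k) \<omega> * f (grid_path (real k * e) e \<omega>))"
  have int_Z: "integrable (P x) (?Z k)" for k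
    unfolding f_path
    using x e C g(2) SN
    by (intro integrable_mult_right integrable_P[where C = C] borel_measurable_times
        borel_measurable_indicator measurable_exit)
      (auto simp: indicator_def sets_P state_in)
  have Z: "(\<integral>\<omega>. ?Z k \<omega> \<partial>P x) =
      \<delta> (real (Suc k) * e) * measure (P x) {\<omega> \<in> space N. X e \<omega> = x} ^ k * exit_mean g x e" for k
  proof -
    have "(\<integral>\<omega>. indicator (S k) \<omega> * f (grid_path (real k * e) e \<omega>) \<partial>P x) =
        measure (P x) (S k) * (\<integral>\<omega>. f (grid_path 0 e \<omega>) \<partial>P x)"
      using e by (intro integral_markov_state x S(1) f) (auto simp: S_def)
    moreover have "f (grid_path 0 e \<omega>) = (if X e \<omega> = x then 0 else g (X e \<omega>))" for \<omega>
      by (simp add: f_def grid_path_def)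
    ultimately show ?thesis
      using S(2)[of k] by (simp add: exit_mean_def)
  qed
  have "(\<Sum>k<n. \<delta> (real (Suc k) * e) * measure (P x) {\<omega> \<in> space N. X e \<omega> = x} ^ k) * exit_mean g x e =
      (\<integral>\<omega>. (\<Sum>k<n. ?Z k \<omega>) \<partial>P x)"
    using int_Z by (simp only: Bochner_Integration.integral_sum Z sum_distrib_right)
  also have "\<dots> \<le> (\<integral>\<omega>. grid_payoff 0 e (- {x}) g (grid_path 0 e \<omega>) \<partial>P x)"
  proof (rule integral_mono)
    show "integrable (P x) (\<lambda>\<omega>. \<Sum>k<n. ?Z k \<omega>)"
      using int_Z by (rule Bochner_Integration.integrable_sum)
    show "integrable (P x) (\<lambda>\<omega>. grid_payoff 0 e (- {x}) g (grid_path 0 e \<omega>))"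
      using x e g(2) by (intro integrable_grid_payoff[where C = C]) auto
    fix \<omega> assume "\<omega> \<in> space (P x)"
    then have \<omega>: "\<omega> \<in> space N"
      using x by (simp add: space_P)
    have path: "grid_path 0 e \<omega> k = X (real k * e) \<omega>" for k
      by (simp add: grid_path_def)
    have f_next: "f (grid_path (real k * e) e \<omega>) =
        (if X (real (Suc k) * e) \<omega> = x then 0 else g (X (real (Suc k) * e) \<omega>))" for k
      by (simp add: f_path algebra_simps)
    show "(\<Sum>k<n. ?Z k \<omega>) \<le> grid_payoff 0 e (- {x}) g (grid_path 0 e \<omega>)"
    proof (cases "grid_path 0 e \<omega>" "- {x}" rule: grid_payoff_cases)
      case never
      have "f (grid_path (real k * e) e \<omega>) = 0" for k
        using never[of "Suc k"] by (simp only: path f_next) simp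
      with never show ?thesis
        by (simp add: grid_payoff_never)
    next
      case (hit m)
      have pay: "grid_payoff 0 e (- {x}) g (grid_path 0 e \<omega>) = \<delta> (real m * e) * g (X (real m * e) \<omega>)"
        using grid_payoff_hit[of "grid_path 0 e \<omega>" m, OF hit] by (simp add: path)
      have nonneg: "0 \<le> \<delta> (real m * e) * g (X (real m * e) \<omega>)"
        using e \<omega> by (intro mult_nonneg_nonneg delta_nonneg g(1) state_in) auto
      have "?Z k \<omega> = (if Suc k = m then \<delta> (real m * e) * g (X (real m * e) \<omega>) else 0)" for k
      proof (cases "Suc k" m rule: linorder_cases)
        case less
        then have "X (real (Suc k) * e) \<omega> = x"
          using hit(2)[of "Suc k"] by (simp only: path) simp
        with less show ?thesis
          by (simp only: f_next) simp
      next
        case equal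
        then have "\<omega> \<in> S k" "X (real m * e) \<omega> \<noteq> x"
          using hit \<omega> by (auto simp: S_def path)
        with equal show ?thesis
          by (simp only: f_next) simp
      next
        case greater
        then have "\<omega> \<notin> S k"
          using hit(1) by (auto simp: S_def path intro!: exI[of _ m])
        with greater show ?thesis
          by simp
      qed
      \<comment> \<open>For \<open>m = 0\<close> no term survives; without the condition
        \<open>0 < m\<close>, truncated subtraction would select \<open>k = 0\<close>.\<close>
      then have "(\<Sum>k<n. ?Z k \<omega>) = (\<Sum>k<n. if k = m - 1 \<and> 0 < m then \<delta> (real m * e) * g (X (real m * e) \<omega>) else 0)"
        by (intro sum.cong) auto
      also have "\<dots> \<le> \<delta> (real m * e) * g (X (real m * e) \<omega>)"
        using nonneg by (cases "0 < m") (auto simp: sum.delta)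
      finally show ?thesis
        by (simp only: pay)
    qed
  qed
  finally show ?thesis .
qed

text \<open>With the discount replaced by \<open>exp (- r * t)\<close>, the exit sum is geometric
  with ratio \<open>a e\<close>, and since \<open>(1 - a e) / e\<close> tends to
  \<open>rate_out x + r\<close> the limit is \<open>L / (rate_out x + r)\<close>. The terms beyond
  \<open>t0\<close> carry the additional factor \<open>1 + c\<close>, and their share of the sum
  stays bounded below as the mesh shrinks.\<close>

lemma exit_payoff_ge:
  assumes x: "x \<in> \<X>" and r: "0 < r"
  shows "\<exists>\<kappa>>0. \<forall>g C L. (\<forall>z\<in>\<X>. 0 \<le> g z \<and> g z \<le> C) \<longrightarrow>
    ((\<lambda>t. exit_mean g x t / t) \<longlongrightarrow> L) (at_right 0) \<longrightarrow>
    (1 + \<kappa>) * L \<le> (rate_out x + r) * (\<integral>\<omega>. payoff 0 (- {x}) g \<omega> \<partial>P x)"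
proof -
  interpret prob_space "P x"
    using x by (rule prob_space_P)
  define \<mu> where "\<mu> = rate_out x + r"
  have \<mu>: "0 < \<mu>"
    using rate_out_nonneg[OF x] r by (simp add: \<mu>_def)
  obtain t0 c where t0: "0 < t0" and c: "0 < c"
    and \<delta>_ge: "\<And>t. t0 \<le> t \<Longrightarrow> (1 + c) * exp (- r * t) \<le> \<delta> t"
    using delta_ge_exp_strict by blast
  \<comment> \<open>The gain \<open>\<kappa>\<close> over exponential discounting is made when the chain is still in \<open>x\<close> at time
    \<open>t0\<close>; its exponential factor is a crude lower bound for the discounted probability of that event.\<close>
  define \<kappa> where "\<kappa> = c * exp (- 4 * \<mu> * (t0 + 1))"
  define p where "p t = measure (P x) {\<omega> \<in> space N. X t \<omega> = x}" for t
  define a where "a e = p e * exp (- r * e)" for e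
  have p: "p t = 1 - measure (P x) {\<omega> \<in> space N. X t \<omega> \<noteq> x}" if "0 \<le> t" for t
  proof -
    have "{\<omega> \<in> space N. X t \<omega> = x} = space (P x) - {\<omega> \<in> space N. X t \<omega> \<noteq> x}"
      using x by (auto simp: space_P)
    then show ?thesis
      using measurable_event[OF that, of "- {x}"] x by (simp add: p_def prob_compl sets_P)
  qed
  \<comment> \<open>Here \<open>1 - a e\<close> is split into
    \<open>(1 - p e) * exp (- r * e)\<close>, which contributes \<open>rate_out x\<close>, and
    \<open>1 - exp (- r * e)\<close>, which contributes \<open>r\<close>.\<close>
  have a_lim: "((\<lambda>e. (1 - a e) / e) \<longlongrightarrow> \<mu>) (at_right 0)"
  proof -
    have exp_lim: "((\<lambda>e. exp (- r * e)) \<longlongrightarrow> exp (- r * 0)) (at_right 0)"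
      by (intro tendsto_intros)
    have "((\<lambda>e. exp (- r * e)) has_real_derivative - r) (at 0)"
      by (auto intro!: derivative_eq_intros)
    then have "((\<lambda>e. (exp (- r * e) - 1) / e) \<longlongrightarrow> - r) (at 0)"
      by (simp add: has_field_derivative_iff)
    then have "((\<lambda>e. (exp (- r * e) - 1) / e) \<longlongrightarrow> - r) (at_right 0)"
      by (rule filterlim_mono) (simp_all add: at_le)
    then have "((\<lambda>e. measure (P x) {\<omega> \<in> space N. X e \<omega> \<noteq> x} / e * exp (- r * e) - (exp (- r * e) - 1) / e)
        \<longlongrightarrow> rate_out x * exp (- r * 0) - - r) (at_right 0)"
      by (intro tendsto_diff tendsto_mult exp_lim total_rate[OF x])
    moreover have "\<forall>\<^sub>F e in at_right 0.
        measure (P x) {\<omega> \<in> space N. X e \<omega> \<noteq> x} / e * exp (- r * e) - (exp (- r * e) - 1) / e = (1 - a e) / e"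
      using eventually_at_right_less[of 0]
      by (rule eventually_mono) (simp add: a_def p field_simps)
    ultimately show ?thesis
      by (simp add: \<mu>_def tendsto_cong)
  qed
  have payoff_bound: "(1 + \<kappa>) * L \<le> \<mu> * (\<integral>\<omega>. payoff 0 (- {x}) g \<omega> \<partial>P x)"
    if g: "\<And>z. z \<in> \<X> \<Longrightarrow> 0 \<le> g z" "\<And>z. z \<in> \<X> \<Longrightarrow> \<bar>g z\<bar> \<le> C"
      and L: "((\<lambda>t. exit_mean g x t / t) \<longlongrightarrow> L) (at_right 0)" for g C L
  proof -
    define G where "G e = (\<integral>\<omega>. grid_payoff 0 e (- {x}) g (grid_path 0 e \<omega>) \<partial>P x)" for e
    have m: "0 \<le> exit_mean g x e" if "0 \<le> e" for e
      unfolding exit_mean_def using that g(1) x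
      by (intro integral_nonneg_AE AE_I2) (auto simp: space_P intro: state_in)
    \<comment> \<open>The left side is arranged into quotients with known limits. The smallness
      conditions give \<open>1 - 2 * \<mu> * e < a e\<close> and put \<open>2 * \<mu> * e\<close> in
      the range of \<open>exp_le_one_minus\<close>.\<close>
    have bound: "exit_mean g x e / e * (exp (- r * e) * (1 + \<kappa>) / ((1 - a e) / e)) \<le> G e"
      if e: "0 < e" "e \<le> 1" and small: "(1 - a e) / e < 2 * \<mu>" "2 * \<mu> * e \<le> 1 / 2" for e
    proof -
      have p01: "0 \<le> p e" "p e \<le> 1"
        by (auto simp: p_def)
      have a: "0 \<le> a e" "a e < 1"
      proof -
        show "0 \<le> a e"
          using p01 by (simp add: a_def)
        have "a e \<le> 1 * exp (- r * e)"
          unfolding a_def using p01 by (intro mult_right_mono) auto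
        also have "\<dots> < 1"
          using r e by simp
        finally show "a e < 1" .
      qed
      \<comment> \<open>The first grid index at or beyond \<open>t0\<close>. As
        \<open>e \<le> 1\<close>, its time is at most \<open>t0 + 1\<close>, the time appearing in
        \<open>\<kappa>\<close>.\<close>
      define K where "K = nat \<lceil>t0 / e\<rceil>"
      have K: "t0 \<le> real K * e" "real K * e \<le> t0 + e"
      proof -
        have "0 \<le> t0 / e"
          using t0 e by simp
        then have "real K = of_int \<lceil>t0 / e\<rceil>"
          unfolding K_def by (subst of_nat_nat) auto
        then have "t0 / e \<le> real K" "real K \<le> t0 / e + 1"
          by linarith+
        then show "t0 \<le> real K * e" "real K * e \<le> t0 + e"
          using e by (auto simp: field_simps)
      qed
      have "exp (- 4 * \<mu> * (t0 + 1)) \<le> exp (- 4 * \<mu> * (real K * e))"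
        using K(2) e \<mu> by simp
      also have "\<dots> = exp (- 2 * (2 * \<mu> * e)) ^ K"
        by (simp add: algebra_simps flip: exp_of_nat_mult)
      also have "\<dots> \<le> (1 - 2 * \<mu> * e) ^ K"
        using small(2) \<mu> e by (intro power_mono exp_le_one_minus) auto
      also have "\<dots> \<le> a e ^ K"
        using small e by (intro power_mono) (auto simp: field_simps)
      finally have aK: "\<kappa> \<le> c * a e ^ K"
        unfolding \<kappa>_def using c by (intro mult_left_mono) auto
      \<comment> \<open>\<open>b k\<close> bounds the discounted weight of an exit at time
        \<open>(k + 1) * e\<close> from below; the extra share \<open>c\<close> is claimed from
        \<open>k = K\<close> on, when that time is past \<open>t0\<close>.\<close>
      define b where "b k = exp (- r * e) * (a e ^ k + c * (if k < K then 0 else a e ^ k))" for k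
      have tail: "(\<lambda>k. if k < K then 0 else a e ^ k) sums (1 / (1 - a e) * a e ^ K)"
      proof -
        have "(\<lambda>k. a e ^ k * a e ^ K) sums (1 / (1 - a e) * a e ^ K)"
          using a by (intro sums_mult2 geometric_sums) auto
        then have "(\<lambda>k. if k + K < K then 0 else a e ^ (k + K)) sums (1 / (1 - a e) * a e ^ K)"
          by (simp add: power_add)
        then show ?thesis
          using sums_zero_iff_shift[of K "\<lambda>k. if k < K then 0 else a e ^ k"] by simp
      qed
      have "b sums (exp (- r * e) * (1 / (1 - a e) + c * (1 / (1 - a e) * a e ^ K)))"
        unfolding b_def[abs_def] using a
        by (intro sums_mult sums_add tail geometric_sums) auto
      then have "(\<lambda>n. (\<Sum>k<n. b k) * exit_mean g x e) \<longlonglongrightarrow>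
          exp (- r * e) * (1 / (1 - a e) + c * (1 / (1 - a e) * a e ^ K)) * exit_mean g x e"
        unfolding sums_def by (intro tendsto_mult tendsto_const)
      moreover have "(\<Sum>k<n. b k) * exit_mean g x e \<le> G e" for n
      proof -
        have "b k \<le> \<delta> (real (Suc k) * e) * p e ^ k" for k
        proof -
          have "b k = (1 + (if k < K then 0 else c)) * exp (- r * (real (Suc k) * e)) * p e ^ k"
            by (simp add: b_def a_def power_mult_distrib algebra_simps
                flip: exp_of_nat_mult exp_add)
          also have "\<dots> \<le> \<delta> (real (Suc k) * e) * p e ^ k"
          proof (rule mult_right_mono)
            show "(1 + (if k < K then 0 else c)) * exp (- r * (real (Suc k) * e)) \<le> \<delta> (real (Suc k) * e)"
            proof (cases "k < K")
              case True
              then show ?thesis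
                using delta_ge_exp[of "real (Suc k) * e"] e by simp
            next
              case False
              then have "real K * e \<le> real (Suc k) * e"
                using e by (intro mult_right_mono) auto
              with K(1) False show ?thesis
                using \<delta>_ge[of "real (Suc k) * e"] by simp
            qed
          qed (use p01 in simp)
          finally show ?thesis .
        qed
        then have "(\<Sum>k<n. b k) * exit_mean g x e \<le>
            (\<Sum>k<n. \<delta> (real (Suc k) * e) * p e ^ k) * exit_mean g x e"
          using e by (intro mult_right_mono sum_mono m) auto
        also have "\<dots> \<le> G e"
          unfolding G_def p_def by (rule exit_grid_payoff_ge[OF x e(1) g])
        finally show ?thesis .
      qed
      ultimately have "exp (- r * e) * (1 / (1 - a e) + c * (1 / (1 - a e) * a e ^ K)) * exit_mean g x e \<le> G e"
        by (intro LIMSEQ_le_const2) auto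
      moreover have "exit_mean g x e / e * (exp (- r * e) * (1 + \<kappa>) / ((1 - a e) / e)) =
          exp (- r * e) * ((1 + \<kappa>) * (1 / (1 - a e))) * exit_mean g x e"
        using e a by (simp add: field_simps)
      moreover have "exp (- r * e) * ((1 + \<kappa>) * (1 / (1 - a e))) * exit_mean g x e \<le>
          exp (- r * e) * ((1 + c * a e ^ K) * (1 / (1 - a e))) * exit_mean g x e"
        using aK a e by (intro mult_right_mono mult_left_mono m) auto
      moreover have "exp (- r * e) * ((1 + c * a e ^ K) * (1 / (1 - a e))) * exit_mean g x e =
          exp (- r * e) * (1 / (1 - a e) + c * (1 / (1 - a e) * a e ^ K)) * exit_mean g x e"
        by (simp add: algebra_simps)
      ultimately show ?thesis
        by linarith
    qed
    define e where "e n = inverse (real (Suc n))" for n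
    have e: "\<And>n. 0 < e n" "e \<longlonglongrightarrow> 0"
      using LIMSEQ_inverse_real_of_nat by (auto simp: e_def[abs_def])
    have e_lim: "filterlim e (at_right 0) sequentially"
      using e by (simp add: filterlim_at less_imp_neq[THEN not_sym])
    have "((\<lambda>e. exp (- r * e)) \<longlongrightarrow> exp (- r * 0)) (at_right 0)"
      by (intro tendsto_intros)
    then have "((\<lambda>e. exit_mean g x e / e * (exp (- r * e) * (1 + \<kappa>) / ((1 - a e) / e)))
        \<longlongrightarrow> L * (exp (- r * 0) * (1 + \<kappa>) / \<mu>)) (at_right 0)"
      using \<mu> by (intro tendsto_mult tendsto_divide L a_lim tendsto_const) auto
    then have lim: "(\<lambda>n. exit_mean g x (e n) / e n * (exp (- r * e n) * (1 + \<kappa>) / ((1 - a (e n)) / e n)))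
        \<longlonglongrightarrow> L * (exp (- r * 0) * (1 + \<kappa>) / \<mu>)"
      using e_lim by (rule filterlim_compose)
    have G: "(\<lambda>n. G (e n)) \<longlonglongrightarrow> (\<integral>\<omega>. payoff 0 (- {x}) g \<omega> \<partial>P x)"
      unfolding G_def using x e g(2)
      by (intro integral_grid_payoff_tendsto[where g = "\<lambda>_. g" and C = C]) auto
    have "\<forall>\<^sub>F n in sequentially. (1 - a (e n)) / e n < 2 * \<mu>"
      using order_tendstoD(2)[OF filterlim_compose[OF a_lim e_lim], of "2 * \<mu>"] \<mu> by simp
    moreover have "\<forall>\<^sub>F n in sequentially. e n < 1 / (4 * \<mu>)"
      using order_tendstoD(2)[OF e(2), of "1 / (4 * \<mu>)"] \<mu> by simp
    ultimately have "\<forall>\<^sub>F n in sequentially.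
        exit_mean g x (e n) / e n * (exp (- r * e n) * (1 + \<kappa>) / ((1 - a (e n)) / e n)) \<le> G (e n)"
    proof eventually_elim
      case (elim n)
      then show ?case
        using \<mu> by (intro bound) (auto simp: e_def field_simps)
    qed
    from tendsto_le[OF _ G lim this] have "L * (exp (- r * 0) * (1 + \<kappa>) / \<mu>) \<le>
        (\<integral>\<omega>. payoff 0 (- {x}) g \<omega> \<partial>P x)"
      by simp
    then show ?thesis
      using \<mu> by (simp add: field_simps)
  qed
  have "0 < \<kappa>"
    using c by (simp add: \<kappa>_def)
  moreover have "(1 + \<kappa>) * L \<le> (rate_out x + r) * (\<integral>\<omega>. payoff 0 (- {x}) g \<omega> \<partial>P x)"
    if "\<forall>z\<in>\<X>. 0 \<le> g z \<and> g z \<le> C" "((\<lambda>t. exit_mean g x t / t) \<longlongrightarrow> L) (at_right 0)" for g C L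
    unfolding \<mu>_def[symmetric] by (rule payoff_bound[of g C L]) (use that in auto)
  ultimately show ?thesis
    by blast
qed

section \<open>Deleting one state from an optimal mild equilibrium\<close>

lemma optimal_value_ge:
  assumes "optimal_mild_equilibrium \<X> P X \<delta> S" "mild_equilibrium \<X> P X \<delta> S'" "y \<in> \<X>"
  shows "stop_value y S' \<le> stop_value y S"
  using assms by (auto simp: optimal_mild_equilibrium_def)

lemma integrable_payoff_value:
  assumes "y \<in> \<X>" shows "integrable (P y) (payoff 0 A (\<lambda>z. stop_value z A'))"
proof -
  obtain C where C: "\<And>z. z \<in> \<X> \<Longrightarrow> \<bar>z\<bar> \<le> C"
    using state_bound by blast
  show ?thesis
    using assms value_bound[OF C] by (intro integrable_payoff[where C = C]) auto
qed

lemma integrable_payoff_id: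
  assumes "y \<in> \<X>" shows "integrable (P y) (payoff 0 A (\<lambda>z. z))"
proof -
  obtain C where C: "\<And>z. z \<in> \<X> \<Longrightarrow> \<bar>z\<bar> \<le> C"
    using state_bound by blast
  show ?thesis
    using assms C by (intro integrable_payoff[where C = C]) auto
qed

text \<open>In every state of \<open>S\<close> going on to \<open>S - {x}\<close> is worth at least
  the immediate reward: with equality away from \<open>x\<close>, and by assumption at
  \<open>x\<close>. Superharmonicity then merges the two stages.\<close>

lemma value_remove_ge:
  assumes S: "S \<subseteq> \<X>" and x: "x \<in> S" "x \<le> stop_value x (S - {x})" and y: "y \<in> \<X>"
  shows "stop_value y S \<le> stop_value y (S - {x})"
proof -
  have "z \<le> stop_value z (S - {x})" if "z \<in> S" for z
    using that S x value_stop[of z "S - {x}"] by (cases "z = x") auto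
  then have "stop_value y S \<le> (\<integral>\<omega>. payoff 0 S (\<lambda>z. stop_value z (S - {x})) \<omega> \<partial>P y)"
    unfolding J_eq_payoff[of y S] using y
    by (intro integral_mono integrable_payoff_id integrable_payoff_value payoff_mono) (auto simp: space_P)
  also have "\<dots> \<le> stop_value y (S - {x})"
    using y by (intro value_superharmonic) auto
  finally show ?thesis .
qed

text \<open>The only new condition is the one at \<open>x\<close>, which is assumed; at states
  outside \<open>S\<close> the value has not dropped.\<close>

lemma mild_remove:
  assumes S: "mild_equilibrium \<X> P X \<delta> S" and x: "x \<in> S" "x \<le> stop_value x (S - {x})"
  shows "mild_equilibrium \<X> P X \<delta> (S - {x})"
proof -
  have "S \<subseteq> \<X>"
    using S by (simp add: mild_equilibrium_def)
  have "y \<le> stop_value y (S - {x})" if "y \<in> \<X> - (S - {x})" for y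
  proof (cases "y = x")
    case False
    then have "y \<le> stop_value y S"
      using S that by (auto simp: mild_equilibrium_def)
    also have "\<dots> \<le> stop_value y (S - {x})"
      using that x \<open>S \<subseteq> \<X>\<close> by (intro value_remove_ge) auto
    finally show ?thesis .
  qed (use x in simp)
  then show ?thesis
    using \<open>S \<subseteq> \<X>\<close> by (auto simp: mild_equilibrium_def)
qed

text \<open>Under \<open>S\<close> the value at \<open>x\<close> is exactly \<open>x\<close>. A
  larger value under \<open>S - {x}\<close> would make that set a mild equilibrium beating
  \<open>S\<close> at \<open>x\<close>.\<close>

lemma optimal_remove_le:
  assumes S: "optimal_mild_equilibrium \<X> P X \<delta> S" and x: "x \<in> S"
  shows "stop_value x (S - {x}) \<le> x"
proof (rule ccontr)
  assume less: "\<not> stop_value x (S - {x}) \<le> x"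
  have mild: "mild_equilibrium \<X> P X \<delta> S"
    using S by (simp add: optimal_mild_equilibrium_def)
  then have "x \<in> \<X>"
    using x by (auto simp: mild_equilibrium_def)
  moreover have "stop_value x (S - {x}) \<le> stop_value x S"
    using less x by (intro optimal_value_ge[OF S] mild_remove[OF mild] \<open>x \<in> \<X>\<close>) auto
  ultimately show False
    using less value_stop[of x S] x by simp
qed

text \<open>Stopping at \<open>S\<close> and then going on to \<open>S - {x}\<close> loses something
  only if the stop occurs at \<open>x\<close>. The loss there is \<open>?d\<close>, and discounting
  can only shrink it.\<close>

lemma value_remove_ge_diff:
  assumes S: "S \<subseteq> \<X>" and x: "x \<in> S" "stop_value x (S - {x}) \<le> x" and y: "y \<in> \<X>"
  shows "stop_value y S - (x - stop_value x (S - {x})) \<le> stop_value y (S - {x})"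
proof -
  interpret prob_space "P y"
    using y by (rule prob_space_P)
  let ?d = "x - stop_value x (S - {x})"
  have "payoff 0 S (\<lambda>z. z) \<omega> - ?d \<le> payoff 0 S (\<lambda>z. stop_value z (S - {x})) \<omega>"
    if \<omega>: "\<omega> \<in> space N" for \<omega>
    using \<omega> order_refl
  proof (cases rule: hitting_time_cases[where A = S])
    case never
    then show ?thesis
      using x by (simp add: payoff_def)
  next
    case (hit \<tau>)
    have "X \<tau> \<omega> - ?d * of_bool (X \<tau> \<omega> = x) = stop_value (X \<tau> \<omega>) (S - {x})"
      using hit S value_stop[of "X \<tau> \<omega>" "S - {x}"] by (auto simp: of_bool_def)
    moreover have "\<delta> \<tau> * (?d * of_bool (X \<tau> \<omega> = x)) \<le> 1 * ?d"
      using hit(1) x delta_le_1[of \<tau>] delta_nonneg[of \<tau>] by (intro mult_mono) auto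
    ultimately show ?thesis
      using hit(2) by (simp add: payoff_def algebra_simps flip: \<open>_ = stop_value _ _\<close>)
  qed
  then have "(\<integral>\<omega>. payoff 0 S (\<lambda>z. z) \<omega> - ?d \<partial>P y) \<le> (\<integral>\<omega>. payoff 0 S (\<lambda>z. stop_value z (S - {x})) \<omega> \<partial>P y)"
    using y by (intro integral_mono integrable_payoff_value Bochner_Integration.integrable_diff integrable_payoff_id)
      (auto simp: space_P)
  also have "\<dots> \<le> stop_value y (S - {x})"
    using y by (intro value_superharmonic) auto
  finally show ?thesis
    using integrable_payoff_id[OF y, of S] by (simp add: J_eq_payoff prob_space)
qed

text \<open>The first-order form of the equilibrium condition at \<open>x\<close>. Strictness is
  essential for its use, since the gap has to absorb the \<open>o(s)\<close> error of the expansion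
  at small times \<open>s\<close>.\<close>

lemma exit_rate_less:
  assumes S: "optimal_mild_equilibrium \<X> P X \<delta> S" and x: "x \<in> S" "0 < x" and r: "0 < r"
    and L: "((\<lambda>t. exit_mean (\<lambda>y. stop_value y S) x t / t) \<longlongrightarrow> L) (at_right 0)"
  shows "L < (rate_out x + r) * x"
proof (rule ccontr)
  assume "\<not> L < (rate_out x + r) * x"
  then have L_ge: "(rate_out x + r) * x \<le> L"
    by simp
  have "S \<subseteq> \<X>"
    using S by (simp add: optimal_mild_equilibrium_def mild_equilibrium_def)
  then have xX: "x \<in> \<X>"
    using x by auto
  interpret prob_space "P x"
    using xX by (rule prob_space_P)
  obtain C where C: "\<And>z. z \<in> \<X> \<Longrightarrow> \<bar>z\<bar> \<le> C"
    using state_bound by blast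
  define h where "h y = stop_value y (S - {x})" for y
  define d where "d = x - h x"
  have h: "\<And>z. z \<in> \<X> \<Longrightarrow> 0 \<le> h z" "\<And>z. z \<in> \<X> \<Longrightarrow> \<bar>h z\<bar> \<le> C"
    using value_nonneg value_bound[OF C] by (auto simp: h_def)
  have v: "\<And>z. z \<in> \<X> \<Longrightarrow> \<bar>stop_value z S\<bar> \<le> C"
    using value_bound[OF C] by auto
  have "h x \<le> x"
    unfolding h_def by (rule optimal_remove_le[OF S x(1)])
  obtain L' where L': "((\<lambda>t. exit_mean h x t / t) \<longlongrightarrow> L') (at_right 0)"
    using exit_mean_tendsto[OF xX, of h C] h(2) by blast
  \<comment> \<open>After an exit, deleting \<open>x\<close> from \<open>S\<close> costs at most
    \<open>d\<close>, and exits occur at rate \<open>rate_out x\<close>.\<close>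
  have "L - d * rate_out x \<le> L'"
  proof (rule tendsto_le[OF _ L'])
    show "((\<lambda>t. exit_mean (\<lambda>y. stop_value y S) x t / t -
        d * (measure (P x) {\<omega> \<in> space N. X t \<omega> \<noteq> x} / t)) \<longlongrightarrow> L - d * rate_out x) (at_right 0)"
      by (intro tendsto_intros L total_rate xX)
    show "\<forall>\<^sub>F t in at_right 0. exit_mean (\<lambda>y. stop_value y S) x t / t -
        d * (measure (P x) {\<omega> \<in> space N. X t \<omega> \<noteq> x} / t) \<le> exit_mean h x t / t"
      using eventually_at_right_less[of 0]
    proof eventually_elim
      case (elim t)
      let ?D = "{\<omega> \<in> space N. X t \<omega> \<noteq> x}"
      have D: "?D \<in> sets (P x)"
        using measurable_event[of t "- {x}"] elim xX by (simp add: sets_P)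
      have int_v: "integrable (P x) (\<lambda>\<omega>. if X t \<omega> = x then 0 else stop_value (X t \<omega>) S)"
        using elim v by (intro integrable_exit[where C = C] xX) auto
      have int_h: "integrable (P x) (\<lambda>\<omega>. if X t \<omega> = x then 0 else h (X t \<omega>))"
        using elim h(2) by (intro integrable_exit[where C = C] xX) auto
      have ind: "integrable (P x) (indicat_real ?D)"
        using D by (auto intro!: integrable_real_indicator simp: less_top[symmetric])
      have "exit_mean (\<lambda>y. stop_value y S) x t - d * measure (P x) ?D =
          (\<integral>\<omega>. (if X t \<omega> = x then 0 else stop_value (X t \<omega>) S) - d * indicator ?D \<omega> \<partial>P x)"
        unfolding exit_mean_def using int_v ind D by (subst Bochner_Integration.integral_diff) auto
      also have "\<dots> \<le> exit_mean h x t"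
        unfolding exit_mean_def
      proof (rule integral_mono)
        fix \<omega> assume "\<omega> \<in> space (P x)"
        then have "\<omega> \<in> space N" "X t \<omega> \<in> \<X>"
          using xX elim by (auto simp: space_P intro: state_in)
        then show "(if X t \<omega> = x then 0 else stop_value (X t \<omega>) S) - d * indicator ?D \<omega> \<le>
            (if X t \<omega> = x then 0 else h (X t \<omega>))"
          using value_remove_ge_diff[OF \<open>S \<subseteq> \<X>\<close> x(1), of "X t \<omega>"] \<open>h x \<le> x\<close>
          by (auto simp: d_def h_def)
      qed (use int_v int_h ind in auto)
      finally have "(exit_mean (\<lambda>y. stop_value y S) x t - d * measure (P x) ?D) / t \<le> exit_mean h x t / t"
        using elim by (intro divide_right_mono) auto
      then show ?case
        by (simp add: diff_divide_distrib)
    qed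
  qed simp
  obtain \<kappa> where \<kappa>: "0 < \<kappa>" and *: "(1 + \<kappa>) * L' \<le> (rate_out x + r) * (\<integral>\<omega>. payoff 0 (- {x}) h \<omega> \<partial>P x)"
  proof -
    have "\<forall>z\<in>\<X>. 0 \<le> h z \<and> h z \<le> C"
      using h by force
    with exit_payoff_ge[OF xX r] L' show ?thesis
      using that by blast
  qed
  \<comment> \<open>Leaving \<open>x\<close> comes before reaching \<open>S - {x}\<close>, so
    superharmonicity applies with the larger set \<open>- {x}\<close>.\<close>
  have "(\<integral>\<omega>. payoff 0 (- {x}) h \<omega> \<partial>P x) \<le> h x"
    unfolding h_def using xX by (intro value_superharmonic) auto
  then have "(1 + \<kappa>) * L' \<le> (rate_out x + r) * h x"
    using * rate_out_nonneg[OF xX] r by (smt (verit) mult_left_mono)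
  \<comment> \<open>Inserting \<open>d = x - h x\<close> and the assumed bound on \<open>L\<close>
    into \<open>L - d * rate_out x\<close> leaves \<open>r * x + rate_out x * h x\<close>. This is
    positive and at least \<open>(rate_out x + r) * h x\<close>, so the factor
    \<open>1 + \<kappa>\<close> is impossible.\<close>
  moreover have "(1 + \<kappa>) * (r * x + rate_out x * h x) \<le> (1 + \<kappa>) * L'"
    using \<open>L - d * rate_out x \<le> L'\<close> L_ge \<kappa> by (intro mult_left_mono) (auto simp: d_def algebra_simps)
  moreover have "0 < \<kappa> * (r * x + rate_out x * h x)"
    using \<kappa> r x rate_out_nonneg[OF xX] h(1)[OF xX] by (intro mult_pos_pos add_pos_nonneg) auto
  moreover have "r * h x \<le> r * x"
    using \<open>h x \<le> x\<close> r by (intro mult_left_mono) auto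
  ultimately show False
    by (simp add: algebra_simps)
qed

text \<open>The bound of \<open>delayed_payoff_le\<close>, minus \<open>x\<close> and divided by the
  elapsed time, tends to \<open>L - (rate_out x + r) * x\<close>. This limit is negative by
  \<open>exit_rate_less\<close>.\<close>

lemma strong_at_positive:
  assumes S: "optimal_mild_equilibrium \<X> P X \<delta> S" and x: "x \<in> S" "0 < x" and r: "0 < r"
  shows "\<forall>\<^sub>F s in at_right 0. (\<integral>\<omega>. payoff s S (\<lambda>z. z) \<omega> \<partial>P x) \<le> x"
proof -
  have xX: "x \<in> \<X>"
    using S x by (auto simp: optimal_mild_equilibrium_def mild_equilibrium_def)
  interpret prob_space "P x"
    using xX by (rule prob_space_P)
  obtain C where C: "\<And>z. z \<in> \<X> \<Longrightarrow> \<bar>z\<bar> \<le> C"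
    using state_bound by blast
  let ?v = "\<lambda>y. stop_value y S"
  have v: "\<And>z. z \<in> \<X> \<Longrightarrow> \<bar>?v z\<bar> \<le> C"
    using value_bound[OF C] by auto
  obtain L where L: "((\<lambda>t. exit_mean ?v x t / t) \<longlongrightarrow> L) (at_right 0)"
    using exit_mean_tendsto[OF xX, of ?v C] v by blast
  let ?D = "\<lambda>t. {\<omega> \<in> space N. X t \<omega> \<noteq> x}"
  have "((\<lambda>t. (\<delta> t - 1) / t * x - \<delta> t * x * (measure (P x) (?D t) / t) + exit_mean ?v x t / t)
      \<longlongrightarrow> - r * x - 1 * x * rate_out x + L) (at_right 0)"
    by (intro tendsto_intros delta_quotient delta_tendsto_1 total_rate xX L)
  moreover have "- r * x - 1 * x * rate_out x + L < 0"
    using exit_rate_less[OF S x r L] by (simp add: algebra_simps)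
  ultimately have "\<forall>\<^sub>F t in at_right 0.
      (\<delta> t - 1) / t * x - \<delta> t * x * (measure (P x) (?D t) / t) + exit_mean ?v x t / t < 0"
    by (rule order_tendstoD)
  then show ?thesis
    using eventually_at_right_less[of 0]
  proof eventually_elim
    case (elim t)
    have D: "?D t \<in> sets (P x)"
      using measurable_event[of t "- {x}"] elim xX by (simp add: sets_P)
    have int: "integrable (P x) (\<lambda>\<omega>. if X t \<omega> = x then 0 else ?v (X t \<omega>))"
      using elim v by (intro integrable_exit[where C = C] xX) auto
    have ind: "integrable (P x) (indicat_real (?D t))"
      using D by (auto intro!: integrable_real_indicator simp: less_top[symmetric])
    have "(\<integral>\<omega>. payoff t S (\<lambda>z. z) \<omega> \<partial>P x) \<le> (\<integral>\<omega>. (if X t \<omega> = x then \<delta> t * x else ?v (X t \<omega>)) \<partial>P x)"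
      using elim x xX by (intro delayed_payoff_le) auto
    also have "\<dots> = (\<integral>\<omega>. \<delta> t * x - \<delta> t * x * indicator (?D t) \<omega> + (if X t \<omega> = x then 0 else ?v (X t \<omega>)) \<partial>P x)"
      using xX by (intro Bochner_Integration.integral_cong refl) (auto simp: indicator_def space_P)
    also have "\<dots> = \<delta> t * x - \<delta> t * x * measure (P x) (?D t) + exit_mean ?v x t"
      unfolding exit_mean_def using int ind D by (simp add: prob_space)
    finally have "(\<integral>\<omega>. payoff t S (\<lambda>z. z) \<omega> \<partial>P x) - x \<le>
        \<delta> t * x - \<delta> t * x * measure (P x) (?D t) + exit_mean ?v x t - x"
      by simp
    also have "\<dots> = ((\<delta> t - 1) / t * x - \<delta> t * x * (measure (P x) (?D t) / t) + exit_mean ?v x t / t) * t"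
      using elim by (simp add: field_simps)
    also have "\<dots> \<le> 0"
      using elim by (intro mult_nonpos_nonneg) auto
    finally show ?case
      by simp
  qed
qed

text \<open>At state \<open>0\<close> the argument is pathwise. A value of at most \<open>0\<close>
  forces the nonnegative payoff to vanish almost surely; as \<open>\<delta>\<close> and all states
  of \<open>S - {0}\<close> are positive, the chain almost surely never visits
  \<open>S - {0}\<close>. A delayed stop can then occur only in \<open>0\<close>.\<close>

lemma strong_at_zero:
  assumes S: "optimal_mild_equilibrium \<X> P X \<delta> S" and x: "0 \<in> S" and s: "0 \<le> s"
  shows "(\<integral>\<omega>. payoff s S (\<lambda>z. z) \<omega> \<partial>P 0) \<le> 0"
proof -
  have SX: "S \<subseteq> \<X>"
    using S by (auto simp: optimal_mild_equilibrium_def mild_equilibrium_def)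
  then have xX: "0 \<in> \<X>"
    using x by auto
  let ?S = "S - {0}"
  have "(\<integral>\<omega>. payoff 0 ?S (\<lambda>z. z) \<omega> \<partial>P 0) = 0"
    using optimal_remove_le[OF S x] value_nonneg[OF xX, of ?S] by (simp add: J_eq_payoff)
  moreover have "AE \<omega> in P 0. 0 \<le> payoff 0 ?S (\<lambda>z. z) \<omega>"
    using xX by (intro AE_I2 payoff_nonneg) (auto simp: space_P state_nonneg)
  ultimately have "AE \<omega> in P 0. payoff 0 ?S (\<lambda>z. z) \<omega> = 0"
    using integrable_payoff_id[OF xX] by (simp add: integral_nonneg_eq_0_iff_AE)
  moreover have "payoff s S (\<lambda>z. z) \<omega> = 0" if \<omega>: "\<omega> \<in> space N" and zero: "payoff 0 ?S (\<lambda>z. z) \<omega> = 0" for \<omega>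
  proof -
    have no: "X t \<omega> \<notin> ?S" if "0 \<le> t" for t
      using \<omega> order_refl
    proof (cases rule: hitting_time_cases[where A = ?S])
      case (hit \<tau>)
      then have "0 < \<delta> \<tau> * X \<tau> \<omega>"
        using SX state_nonneg[of "X \<tau> \<omega>"] by (intro mult_pos_pos delta_pos) (auto simp: order_less_le)
      with zero hit show ?thesis
        by (simp add: payoff_def)
    qed (use that in simp)
    show ?thesis
      using \<omega> s
    proof (cases rule: hitting_time_cases[where A = S])
      case (hit \<tau>)
      then show ?thesis
        using no[of \<tau>] s by (simp add: payoff_def)
    qed (simp add: payoff_def)
  qed
  ultimately have "AE \<omega> in P 0. payoff s S (\<lambda>z. z) \<omega> = 0"
    using xX by (auto elim: AE_mp simp: space_P)
  then have "(\<integral>\<omega>. payoff s S (\<lambda>z. z) \<omega> \<partial>P 0) = (\<integral>\<omega>. 0 \<partial>P 0)"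
    using xX s by (intro integral_cong_AE) (auto simp: measurable_P measurable_payoff)
  then show ?thesis
    by simp
qed

theorem optimal_imp_strong:
  assumes S: "optimal_mild_equilibrium \<X> P X \<delta> S" and r: "0 < r"
  shows "strong_equilibrium \<X> P X \<delta> S"
proof -
  have SX: "S \<subseteq> \<X>"
    using S by (auto simp: optimal_mild_equilibrium_def mild_equilibrium_def)
  have "\<exists>\<epsilon>>0. \<forall>\<epsilon>'\<in>{0<..<\<epsilon>}. (\<integral>\<omega>. discounted_state \<delta> X (hitting_time X \<epsilon>' S) \<omega> \<partial>P x) \<le> x"
    if x: "x \<in> S" for x
  proof (cases "x = 0")
    case True
    then show ?thesis
      using strong_at_zero[OF S] x by (intro exI[of _ 1]) (auto simp flip: payoff_id)
  next
    case False
    then have "0 < x"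
      using x SX state_nonneg[of x] by auto
    from strong_at_positive[OF S x this r] show ?thesis
      by (auto simp: eventually_at_right_field simp flip: payoff_id)
  qed
  then show ?thesis
    using S SX by (auto simp: strong_equilibrium_def optimal_mild_equilibrium_def mild_equilibrium_def)
qed

end

theorem theorem2p1:
  fixes \<X> S :: "real set"
    and N :: "'w measure"
    and P :: "real \<Rightarrow> 'w measure"
    and X :: "real \<Rightarrow> 'w \<Rightarrow> real"
    and q :: "real \<Rightarrow> real \<Rightarrow> real"
    and rate_out :: "real \<Rightarrow> real"
    and \<delta> :: "real \<Rightarrow> real"
  assumes chain: "ctmc \<X> N P X q rate_out"
    and states_nonneg: "\<X> \<subseteq> {0..}"
    and discount: "discount_function \<delta>"
    and states_bounded: "bdd_above \<X>"
    and rates_bounded: "bdd_above (rate_out ` \<X>)"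
    and irreducible: "irreducible_chain \<X> P X"
    and log_subadditive: "\<And>s t. 0 < s \<Longrightarrow> 0 < t \<Longrightarrow> \<delta> s * \<delta> t \<le> \<delta> (s + t)"
    and differentiable_0: "\<exists>d<0. (\<delta> has_real_derivative d) (at 0 within {0..})"
    and optimal: "optimal_mild_equilibrium \<X> P X \<delta> S"
  shows "strong_equilibrium \<X> P X \<delta> S"
proof -
  obtain d where d: "d < 0" "(\<delta> has_real_derivative d) (at 0 within {0..})"
    using differentiable_0 by blast
  interpret ctmc \<X> N P X q rate_out
    by (rule chain)
  \<comment> \<open>The rate \<open>r\<close> is minus the given negative derivative, hence
    positive.\<close>
  interpret stopping_problem \<X> N P X q rate_out \<delta> "- d"
    using discount log_subadditive d(2) states_nonneg states_bounded by unfold_locales simp_all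
  show ?thesis
    using optimal d(1) by (intro optimal_imp_strong) auto
qed

end
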